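(* Let $k\geqslant 2$, let $F_k$ be the free group of rank $k$, and let $\phi:F_k\to G$ be an epimorphism onto a finite group $G$. Then the image of the Andrews–Curtis graph $\Delta_k(F_k)$ in the Andrews–Curtis graph $\Delta_k(G)$, under the map $(f_1,\ldots,f_k)\mapsto(\phi(f_1),\ldots,\phi(f_k))$, is connected.
   Context: For a group $G$ and $Y\subseteq G$, $gp_G(Y)$ denotes the normal closure of $Y$ in $G$, and $N_k(G)=\{(g_1,\ldots,g_k)\in G^k \mid gp_G(g_1,\ldots,g_k)=G\}$. The elementary AC-moves (Andrews–Curtis transformations) on $G^k$ are the following, each changing only the $i$-th component of a tuple $(x_1,\ldots,x_k)$: (1) $x_i\mapsto x_ix_j^{\pm1}$ with $j\ne i$; (2) $x_i\mapsto x_j^{\pm1}x_i$ with $j\neq i$; (3) $x_i\mapsto x_i^{-1}$; (4) $x_i\mapsto x_i^{w}=w^{-1}x_iw$ with $w\in G$. The Andrews–Curtis graph $\Delta_k(G)$ has vertex set $N_k(G)$, with two vertices joined by an edge if one is obtained from the other by an elementary AC-move. The same definitions apply to $F_k$. The image of $\Delta_k(F_k)$ is the subgraph of $\Delta_k(G)$ formed by the images of the vertices and edges of $\Delta_k(F_k)$. *)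

theory Defs
  imports "HOL-Algebra.Coset" "Graph_Theory.Digraph_Component"
begin

section \<open>Free groups\<close>

text \<open>
  The free group on a set \<open>S\<close>, realised by reduced words.  The letter \<open>(s, True)\<close> stands for the
  generator \<open>s\<close> and \<open>(s, False)\<close> for its formal inverse.
\<close>

type_synonym 'a letter = "'a \<times> bool"

definition inv_letter :: "'a letter \<Rightarrow> 'a letter" where
  "inv_letter x = (fst x, \<not> snd x)"

definition reduced :: "'a letter list \<Rightarrow> bool" where
  "reduced w \<longleftrightarrow> successively (\<lambda>x y. y \<noteq> inv_letter x) w"

fun lcons :: "'a letter \<Rightarrow> 'a letter list \<Rightarrow> 'a letter list" where
  "lcons x [] = [x]"
| "lcons x (y # w) = (if y = inv_letter x then w else x # y # w)"

definition free_group :: "'a set \<Rightarrow> 'a letter list monoid" where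
  "free_group S =
     \<lparr>carrier = {w. reduced w \<and> fst ` set w \<subseteq> S}, monoid.mult = (\<lambda>u v. foldr lcons u v), one = []\<rparr>"

abbreviation free_group_rank :: "nat \<Rightarrow> nat letter list monoid" where
  "free_group_rank k \<equiv> free_group {..<k}"

lemma inv_letter_simps [simp]:
  "inv_letter (inv_letter x) = x" "fst (inv_letter x) = fst x" "inv_letter x \<noteq> x" "x \<noteq> inv_letter x"
  by (auto simp: inv_letter_def prod_eq_iff)

lemma inv_letter_eq_iff: "inv_letter x = y \<longleftrightarrow> x = inv_letter y"
  by (auto simp: inv_letter_def prod_eq_iff)

lemma reduced_Nil [simp]: "reduced []"
  by (simp add: reduced_def)

lemma reduced_Cons:
  "reduced (x # w) \<longleftrightarrow> reduced w \<and> (w = [] \<or> hd w \<noteq> inv_letter x)"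
  by (auto simp: reduced_def successively_Cons)

lemma reduced_lcons: "reduced w \<Longrightarrow> reduced (lcons x w)"
  by (cases w) (auto simp: reduced_Cons)

lemma reduced_foldr_lcons: "reduced v \<Longrightarrow> reduced (foldr lcons u v)"
  by (induction u) (auto simp: reduced_lcons)

lemma lcons_letters: "fst ` set w \<subseteq> S \<Longrightarrow> fst x \<in> S \<Longrightarrow> fst ` set (lcons x w) \<subseteq> S"
  by (cases w) auto

lemma foldr_lcons_letters:
  "fst ` set u \<subseteq> S \<Longrightarrow> fst ` set v \<subseteq> S \<Longrightarrow> fst ` set (foldr lcons u v) \<subseteq> S"
  by (induction u) (simp_all add: lcons_letters)

lemma lcons_cancel: "reduced w \<Longrightarrow> lcons x (lcons (inv_letter x) w) = w"
  by (cases w; cases "tl w") (auto simp: reduced_Cons)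

lemma lcons_reduced: "reduced (x # w) \<Longrightarrow> lcons x w = x # w"
  by (cases w) (auto simp: reduced_Cons)

lemma foldr_lcons_Nil: "reduced w \<Longrightarrow> foldr lcons w [] = w"
  by (induction w) (auto simp: reduced_Cons intro!: lcons_reduced)

lemma foldr_lcons_lcons:
  assumes "reduced w"
  shows "foldr lcons (lcons x v) w = lcons x (foldr lcons v w)"
proof (cases v)
  case (Cons y v')
  then show ?thesis
    using lcons_cancel[OF reduced_foldr_lcons[OF assms], of x v'] by auto
qed auto

lemma foldr_lcons_assoc:
  "reduced w \<Longrightarrow> foldr lcons (foldr lcons u v) w = foldr lcons u (foldr lcons v w)"
  by (induction u) (auto simp: foldr_lcons_lcons)

lemma foldr_lcons_inv:
  "reduced v \<Longrightarrow> foldr lcons (rev (map inv_letter w)) (foldr lcons w v) = v"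
proof (induction w)
  case (Cons x w)
  have "lcons (inv_letter x) (lcons x (foldr lcons w v)) = foldr lcons w v"
    using lcons_cancel[OF reduced_foldr_lcons[OF Cons.prems], of "inv_letter x" w] by simp
  with Cons show ?case by simp
qed auto

lemma group_free_group: "group (free_group S)"
proof (rule groupI)
  fix w assume w: "w \<in> carrier (free_group S)"
  let ?w' = "foldr lcons (rev (map inv_letter w)) []"
  have "fst ` set (rev (map inv_letter w)) \<subseteq> S"
    using w by (auto simp: free_group_def image_image)
  then have "?w' \<in> carrier (free_group S)"
    using foldr_lcons_letters[of _ S "[]"] by (auto simp: free_group_def reduced_foldr_lcons)
  moreover have "?w' \<otimes>\<^bsub>free_group S\<^esub> w = \<one>\<^bsub>free_group S\<^esub>"
    using w foldr_lcons_inv[of "[]" w]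
    by (auto simp: free_group_def foldr_lcons_assoc foldr_lcons_Nil)
  ultimately show "\<exists>v\<in>carrier (free_group S). v \<otimes>\<^bsub>free_group S\<^esub> w = \<one>\<^bsub>free_group S\<^esub>"
    by blast
qed (simp_all add: free_group_def reduced_foldr_lcons foldr_lcons_assoc foldr_lcons_letters
       del: image_subset_iff)

context group
begin

definition eval_letter :: "('s \<Rightarrow> 'a) \<Rightarrow> 's letter \<Rightarrow> 'a" where
  "eval_letter h x = (if snd x then h (fst x) else inv (h (fst x)))"

definition eval_word :: "('s \<Rightarrow> 'a) \<Rightarrow> 's letter list \<Rightarrow> 'a" where
  "eval_word h w = foldr (\<lambda>x g. eval_letter h x \<otimes> g) w \<one>"

lemma eval_letter_closed: "h \<in> S \<rightarrow> carrier G \<Longrightarrow> fst x \<in> S \<Longrightarrow> eval_letter h x \<in> carrier G"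
  by (auto simp: eval_letter_def)

lemma eval_word_closed:
  "h \<in> S \<rightarrow> carrier G \<Longrightarrow> fst ` set w \<subseteq> S \<Longrightarrow> eval_word h w \<in> carrier G"
  by (induction w) (auto simp: eval_word_def intro: eval_letter_closed)

lemma eval_word_Cons: "eval_word h (x # w) = eval_letter h x \<otimes> eval_word h w"
  by (simp add: eval_word_def)

lemma eval_word_lcons:
  assumes "h \<in> S \<rightarrow> carrier G" "fst x \<in> S" "fst ` set w \<subseteq> S"
  shows "eval_word h (lcons x w) = eval_letter h x \<otimes> eval_word h w"
proof (cases "w \<noteq> [] \<and> hd w = inv_letter x")
  case True
  then obtain v where v: "w = inv_letter x # v" by (cases w) auto
  have "eval_word h v \<in> carrier G" using assms v by (auto intro: eval_word_closed)
  moreover have "h (fst x) \<in> carrier G" using assms by auto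
  ultimately show ?thesis
    by (auto simp: v eval_word_Cons eval_letter_def inv_letter_def m_assoc[symmetric])
next
  case False
  then have "lcons x w = x # w" by (cases w) auto
  then show ?thesis by (simp add: eval_word_Cons)
qed

lemma eval_word_mult:
  assumes "h \<in> S \<rightarrow> carrier G" "fst ` set u \<subseteq> S" "fst ` set v \<subseteq> S"
  shows "eval_word h (foldr lcons u v) = eval_word h u \<otimes> eval_word h v"
  using assms(2)
proof (induction u)
  case Nil
  then show ?case using eval_word_closed[OF assms(1,3)] by (simp add: eval_word_def)
next
  case (Cons x u)
  then have "fst ` set (foldr lcons u v) \<subseteq> S" using assms(3) by (intro foldr_lcons_letters) auto
  with Cons assms eval_word_closed[OF assms(1,3)] eval_word_closed[OF assms(1), of u]
    eval_letter_closed[OF assms(1), of x]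
  show ?case by (auto simp: eval_word_lcons eval_word_Cons m_assoc)
qed

lemma eval_word_hom:
  assumes "h \<in> S \<rightarrow> carrier G"
  shows "eval_word h \<in> hom (free_group S) G"
  unfolding hom_def free_group_def
  by (auto simp del: image_subset_iff intro: eval_word_closed[OF assms] eval_word_mult[OF assms])

text \<open>The universal property of the free group.\<close>

theorem free_group_universal:
  assumes h: "h \<in> S \<rightarrow> carrier G"
  shows "\<exists>f \<in> hom (free_group S) G. \<forall>s\<in>S. f [(s, True)] = h s"
    and "\<lbrakk>f \<in> hom (free_group S) G; f' \<in> hom (free_group S) G;
          \<forall>s\<in>S. f [(s, True)] = h s; \<forall>s\<in>S. f' [(s, True)] = h s; w \<in> carrier (free_group S)\<rbrakk>
         \<Longrightarrow> f w = f' w"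
proof -
  show "\<exists>f \<in> hom (free_group S) G. \<forall>s\<in>S. f [(s, True)] = h s"
    using h by (intro bexI[OF _ eval_word_hom]) (auto simp: eval_word_def eval_letter_def Pi_iff)
next
  interpret F: group "free_group S" by (rule group_free_group)
  have *: "f w = eval_word h w"
    if f: "f \<in> hom (free_group S) G" "\<forall>s\<in>S. f [(s, True)] = h s" and "w \<in> carrier (free_group S)"
    for f w
    using that(3)
  proof (induction w)
    case Nil
    then show ?case using hom_one[OF f(1) F.is_group is_group]
      by (simp add: eval_word_def free_group_def)
  next
    case (Cons x w)
    have c: "[x] \<in> carrier (free_group S)" "w \<in> carrier (free_group S)" "fst x \<in> S"
      "[inv_letter x] \<in> carrier (free_group S)"
      using Cons.prems by (auto simp: free_group_def reduced_Cons)
    have "x # w = [x] \<otimes>\<^bsub>free_group S\<^esub> w"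
      using Cons.prems by (simp add: free_group_def lcons_reduced)
    then have "f (x # w) = f [x] \<otimes> f w" using c hom_mult[OF f(1)] by simp
    moreover have "f [x] = eval_letter h x"
    proof (cases "snd x")
      case True
      then show ?thesis using f(2) c by (cases x) (auto simp: eval_letter_def)
    next
      case False
      have "[x] \<otimes>\<^bsub>free_group S\<^esub> [inv_letter x] = \<one>\<^bsub>free_group S\<^esub>"
        by (simp add: free_group_def)
      then have "f [x] \<otimes> f [inv_letter x] = \<one>"
        using c hom_mult[OF f(1)] hom_one[OF f(1) F.is_group is_group] by metis
      moreover have "f [inv_letter x] = h (fst x)" using f(2) c False
        by (auto simp: inv_letter_def)
      ultimately show ?thesis using c hom_in_carrier[OF f(1)] False h
        by (auto simp: eval_letter_def intro!: inv_equality[symmetric])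
    qed
    ultimately show ?case using Cons.IH c by (simp add: eval_word_Cons)
  qed
  show "f w = f' w" if "f \<in> hom (free_group S) G" "f' \<in> hom (free_group S) G"
    "\<forall>s\<in>S. f [(s, True)] = h s" "\<forall>s\<in>S. f' [(s, True)] = h s" "w \<in> carrier (free_group S)"
    using *[of f w] *[of f' w] that by simp
qed

end


section \<open>The Andrews--Curtis graph\<close>

definition normal_closure :: "('a, 'b) monoid_scheme \<Rightarrow> 'a set \<Rightarrow> 'a set" where
  "normal_closure G Y = \<Inter> {N. N \<lhd> G \<and> Y \<subseteq> N}"

text \<open>Tuples in \<open>G\<^sup>k\<close> are lists of length \<open>k\<close>.\<close>

definition normally_generating :: "nat \<Rightarrow> ('a, 'b) monoid_scheme \<Rightarrow> 'a list set" where
  "normally_generating k G =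
     {xs. length xs = k \<and> set xs \<subseteq> carrier G \<and> normal_closure G (set xs) = carrier G}"

inductive ac_move :: "('a, 'b) monoid_scheme \<Rightarrow> 'a list \<Rightarrow> 'a list \<Rightarrow> bool" for G (structure) where
  mult_right: "\<lbrakk>i < length xs; j < length xs; i \<noteq> j\<rbrakk> \<Longrightarrow> ac_move G xs (xs[i := xs ! i \<otimes> xs ! j])"
| mult_right_inv: "\<lbrakk>i < length xs; j < length xs; i \<noteq> j\<rbrakk> \<Longrightarrow> ac_move G xs (xs[i := xs ! i \<otimes> inv (xs ! j)])"
| mult_left: "\<lbrakk>i < length xs; j < length xs; i \<noteq> j\<rbrakk> \<Longrightarrow> ac_move G xs (xs[i := xs ! j \<otimes> xs ! i])"
| mult_left_inv: "\<lbrakk>i < length xs; j < length xs; i \<noteq> j\<rbrakk> \<Longrightarrow> ac_move G xs (xs[i := inv (xs ! j) \<otimes> xs ! i])"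
| invert: "i < length xs \<Longrightarrow> ac_move G xs (xs[i := inv (xs ! i)])"
| conjugate: "\<lbrakk>i < length xs; w \<in> carrier G\<rbrakk> \<Longrightarrow> ac_move G xs (xs[i := inv w \<otimes> xs ! i \<otimes> w])"

text \<open>An undirected edge is represented by the two arcs joining its endpoints; loops may occur.\<close>

definition ac_graph :: "nat \<Rightarrow> ('a, 'b) monoid_scheme \<Rightarrow> 'a list pair_pre_digraph" where
  "ac_graph k G =
     \<lparr>pverts = normally_generating k G,
      parcs = {(xs, ys). xs \<in> normally_generating k G \<and> ys \<in> normally_generating k G \<and>
                         (ac_move G xs ys \<or> ac_move G ys xs)}\<rparr>"

definition graph_image :: "('a \<Rightarrow> 'b) \<Rightarrow> 'a pair_pre_digraph \<Rightarrow> 'b pair_pre_digraph" where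
  "graph_image f D = \<lparr>pverts = f ` pverts D, parcs = map_prod f f ` parcs D\<rparr>"

text \<open>The image of an Andrews--Curtis graph under an epimorphism is indeed a subgraph.\<close>

lemma map_normally_generating:
  assumes "group F" "group G" and \<phi>: "\<phi> \<in> epi F G" and xs: "xs \<in> normally_generating k F"
  shows "map \<phi> xs \<in> normally_generating k G"
proof -
  interpret group_hom F G \<phi>
    using assms by (auto simp: epi_def group_hom_def group_hom_axioms_def)
  have surj: "\<phi> ` carrier F = carrier G" using \<phi> by (simp add: epi_def)
  have sub: "set xs \<subseteq> carrier F" and gen: "normal_closure F (set xs) = carrier F"
    using xs by (auto simp: normally_generating_def)
  have "carrier G \<subseteq> N" if N: "N \<lhd> G" and le: "set (map \<phi> xs) \<subseteq> N" for N
  proof -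
    interpret N: normal N G by fact
    let ?M = "{x \<in> carrier F. \<phi> x \<in> N}"
    have "subgroup ?M F" by (rule G.subgroupI) auto
    then have "?M \<lhd> F"
      by (auto simp: G.normal_inv_iff intro!: N.inv_op_closed2)
    moreover have "set xs \<subseteq> ?M" using sub le by auto
    ultimately have "carrier F \<subseteq> ?M" using gen by (auto simp: normal_closure_def)
    then show ?thesis unfolding surj[symmetric] by blast
  qed
  then have "carrier G \<subseteq> normal_closure G (set (map \<phi> xs))"
    unfolding normal_closure_def by blast
  moreover have c: "carrier G \<lhd> G"
    by (simp add: H.normal_inv_iff H.subgroup_self)
  moreover have m: "set (map \<phi> xs) \<subseteq> carrier G"
    using sub by auto
  ultimately have "normal_closure G (set (map \<phi> xs)) = carrier G"
    unfolding normal_closure_def by blast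
  with m xs show ?thesis
    by (simp add: normally_generating_def)
qed

lemma map_ac_move:
  assumes "group_hom F G \<phi>" and "ac_move F xs ys" and "set xs \<subseteq> carrier F"
  shows "ac_move G (map \<phi> xs) (map \<phi> ys)"
proof -
  interpret group_hom F G \<phi> by fact
  have c: "xs ! i \<in> carrier F" if "i < length xs" for i using that assms(3) by auto
  show ?thesis using assms(2)
  proof cases
    case (mult_right i j)
    then show ?thesis using c ac_move.mult_right[of i "map \<phi> xs" j G] by (simp add: map_update)
  next
    case (mult_right_inv i j)
    then show ?thesis using c ac_move.mult_right_inv[of i "map \<phi> xs" j G] by (simp add: map_update)
  next
    case (mult_left i j)
    then show ?thesis using c ac_move.mult_left[of i "map \<phi> xs" j G] by (simp add: map_update)
  next
    case (mult_left_inv i j)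
    then show ?thesis using c ac_move.mult_left_inv[of i "map \<phi> xs" j G] by (simp add: map_update)
  next
    case (invert i)
    then show ?thesis using c ac_move.invert[of i "map \<phi> xs" G] by (simp add: map_update)
  next
    case (conjugate i w)
    then show ?thesis using c ac_move.conjugate[of i "map \<phi> xs" "\<phi> w" G] by (simp add: map_update)
  qed
qed

lemma graph_image_subgraph:
  assumes "group F" "group G" and \<phi>: "\<phi> \<in> epi F G"
  shows "subgraph (graph_image (map \<phi>) (ac_graph k F)) (ac_graph k G)"
proof -
  have hom: "group_hom F G \<phi>"
    using assms by (auto simp: epi_def group_hom_def group_hom_axioms_def)
  note * = map_normally_generating[OF assms] map_ac_move[OF hom]
  have "xs \<in> normally_generating k F \<Longrightarrow> set xs \<subseteq> carrier F" for xs
    by (simp add: normally_generating_def)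
  then show ?thesis
    by (fastforce simp: subgraph_def graph_image_def ac_graph_def wf_digraph_def dest: *)
qed

end

theory Submission
  imports Defs "HOL-Algebra.Generated_Groups"
begin

text \<open>
  Elementary moves lift along epimorphisms, so a path in the Andrews--Curtis graph of \<open>G\<close> that starts
  at the image of a tuple of \<open>F\<^sub>k\<close> is itself the image of a path.  It therefore suffices to join the
  images of any two normally generating tuples of \<open>F\<^sub>k\<close> by moves in \<open>G\<close>.

  The abelianization is handled upstairs.  A normally generating tuple of \<open>F\<^sub>k\<close> has vectors of exponent
  sums that span \<open>\<int>\<^sup>k\<close>, and the Euclidean algorithm, performed with moves, turns these vectors into the
  standard basis (lemma \<open>ac_moves_dual_basis\<close>).  This has to happen over \<open>\<int>\<close>: generating tuples of
  a finite abelian group may be told apart by a determinant.  A word with zero exponent sums is mapped into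
  the derived subgroup \<open>G'\<close>, so two tuples of \<open>F\<^sub>k\<close> may be assumed to have images congruent modulo \<open>G'\<close>.

  What remains is a statement about a finite group: for \<open>k \<ge> 2\<close>, normally generating tuples that are
  congruent modulo \<open>G'\<close> are connected by moves (lemma \<open>ac_moves_of_derived_eq\<close>).  Fix a normal subgroup
  \<open>N\<close> and work modulo \<open>N\<close>; the aim is to reach \<open>N = 1\<close>.  The basic tool is that a component may be
  multiplied by anything in the normal closure of the others (lemma \<open>ac_mod_mult\<close>).  Call a normal
  subgroup \<open>X \<supseteq> N\<close> perfect modulo \<open>N\<close> if \<open>X = [X, G] N\<close>.

  \<^item> If \<open>N\<close> is the only such subgroup, then \<open>G / N\<close> is nilpotent.  Dividing out all components but one
    leaves a nilpotent group that is normally generated by one element, hence abelian.  So the other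
    components normally generate a subgroup containing \<open>G'\<close>, and each component can be corrected in turn
    by an element of \<open>G'\<close>.

  \<^item> Otherwise take a minimal \<open>X \<noteq> N\<close> that is perfect modulo \<open>N\<close>.  By induction on the index the tuples
    are connected modulo \<open>X\<close>, and lifting the path makes them congruent modulo \<open>X\<close>.  Let \<open>H\<close> be maximal
    among the normal subgroups with \<open>N \<subseteq> H \<subset> X\<close>, and let \<open>K\<close> be the centralizer of the chief factor
    \<open>X / H\<close>.  Then \<open>K \<noteq> G\<close>, and the normal closure of any \<open>v \<notin> K\<close> together with \<open>N\<close> contains \<open>X\<close>
    (lemma \<open>ex_pivot_kernel\<close>).  Hence a component outside \<open>K\<close> is a pivot: it allows all other components to be
    changed freely within their classes modulo \<open>X\<close>.  Each tuple has a pivot, as it normally generates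
    \<open>G\<close>, and with two components at hand the pivot can be exchanged (lemma \<open>ac_mod_of_outside_pivot\<close>).
\<close>

section \<open>Normal closures and centralizers of factors\<close>

context group
begin

lemma normal_Inter:
  assumes "\<And>N. N \<in> A \<Longrightarrow> N \<lhd> G" and "A \<noteq> {}"
  shows "\<Inter>A \<lhd> G"
proof -
  have "subgroup (\<Inter>A) G"
    using assms by (intro subgroups_Inter) (auto simp: normal_inv_iff)
  then show ?thesis
    using assms by (auto simp: normal_inv_iff)
qed

lemma normal_closure_normal: "Y \<subseteq> carrier G \<Longrightarrow> normal_closure G Y \<lhd> G"
  unfolding normal_closure_def using normal_self by (intro normal_Inter) auto

lemma normal_closure_incl: "Y \<subseteq> normal_closure G Y"
  by (auto simp: normal_closure_def)

lemma normal_closure_memI: "x \<in> Y \<Longrightarrow> x \<in> normal_closure G Y"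
  by (auto simp: normal_closure_def)

lemma normal_closure_least: "N \<lhd> G \<Longrightarrow> Y \<subseteq> N \<Longrightarrow> normal_closure G Y \<subseteq> N"
  by (auto simp: normal_closure_def)

lemma normal_closure_mono: "Y \<subseteq> Z \<Longrightarrow> normal_closure G Y \<subseteq> normal_closure G Z"
  by (auto simp: normal_closure_def)

lemma normal_subset_carrier: "N \<lhd> G \<Longrightarrow> N \<subseteq> carrier G"
  by (simp add: normal_imp_subgroup subgroup.subset)

lemma rcos_eq_iff:
  assumes "subgroup T G" "x \<in> carrier G" "y \<in> carrier G"
  shows "T #> x = T #> y \<longleftrightarrow> x \<otimes> inv y \<in> T"
  using assms
  by (metis coset_join1 coset_join2 coset_mult_inv1 coset_mult_inv2 inv_closed m_closed subgroup.subset)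

definition commutator :: "'a \<Rightarrow> 'a \<Rightarrow> 'a" where
  "commutator x y = x \<otimes> y \<otimes> inv x \<otimes> inv y"

text \<open>
  The centralizer of \<open>S\<close> modulo \<open>T\<close>.  For normal \<open>T\<close> and \<open>S = carrier G\<close> it is the preimage of the
  centre of \<open>G / T\<close>; for normal \<open>T \<subseteq> S\<close> it is the kernel of the action of \<open>G\<close> on \<open>S / T\<close>.
\<close>

definition centralizer_mod :: "'a set \<Rightarrow> 'a set \<Rightarrow> 'a set" where
  "centralizer_mod S T = {g \<in> carrier G. \<forall>x\<in>S. commutator x g \<in> T}"

lemma commutator_closed [simp]:
  "x \<in> carrier G \<Longrightarrow> y \<in> carrier G \<Longrightarrow> commutator x y \<in> carrier G"
  by (simp add: commutator_def)

lemma inv_commutator: "x \<in> carrier G \<Longrightarrow> y \<in> carrier G \<Longrightarrow> inv (commutator x y) = commutator y x"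
  by (simp add: commutator_def inv_mult_group m_assoc)

lemma commutator_in_normal:
  assumes "N \<lhd> G" "x \<in> carrier G" "y \<in> carrier G" "x \<in> N \<or> y \<in> N"
  shows "commutator x y \<in> N"
proof -
  interpret N: normal N G by fact
  show ?thesis
  proof (cases "x \<in> N")
    case True
    then have "x \<otimes> (y \<otimes> inv x \<otimes> inv y) \<in> N"
      using assms(3) N.inv_op_closed2 by (metis N.m_closed N.m_inv_closed)
    then show ?thesis using assms by (simp add: commutator_def m_assoc)
  next
    case False
    then have "x \<otimes> y \<otimes> inv x \<in> N" "inv y \<in> N"
      using assms N.inv_op_closed2 by auto
    then show ?thesis by (simp add: commutator_def)
  qed
qed

lemma commutator_mod_iff:
  assumes "T \<lhd> G" "x \<in> carrier G" "y \<in> carrier G"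
  shows "commutator x y \<in> T \<longleftrightarrow> (T #> x) <#> (T #> y) = (T #> y) <#> (T #> x)"
proof -
  interpret T: normal T G by fact
  have "commutator x y = (x \<otimes> y) \<otimes> inv (y \<otimes> x)"
    using assms by (simp add: commutator_def inv_mult_group m_assoc)
  then show ?thesis
    using assms rcos_eq_iff[OF T.subgroup_axioms, of "x \<otimes> y" "y \<otimes> x"] by (simp add: T.rcos_sum)
qed

lemma commute_inv:
  assumes "x \<in> carrier G" "a \<in> carrier G" "x \<otimes> a = a \<otimes> x"
  shows "x \<otimes> inv a = inv a \<otimes> x"
proof -
  have "x \<otimes> inv a = inv a \<otimes> (a \<otimes> x) \<otimes> inv a"
    using assms(1,2) by (simp add: m_assoc[symmetric])
  also have "\<dots> = inv a \<otimes> x"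
    using assms by (simp add: assms(3)[symmetric] m_assoc)
  finally show ?thesis .
qed

text \<open>
  In \<open>G / T\<close> the condition that defines the centralizer says that two cosets commute, which is visibly
  stable under products and inverses.
\<close>

lemma subgroup_centralizer_mod:
  assumes "T \<lhd> G" "S \<subseteq> carrier G"
  shows "subgroup (centralizer_mod S T) G"
proof -
  interpret T: normal T G by fact
  interpret Q: group "G Mod T" by (rule T.factorgroup_is_group)
  interpret q: group_hom G "G Mod T" "\<lambda>a. T #> a"
    using T.r_coset_hom_Mod by (simp add: group_hom_def group_hom_axioms_def is_group Q.is_group)
  let ?C = "{g \<in> carrier G. \<forall>x\<in>S.
     (T #> x) \<otimes>\<^bsub>G Mod T\<^esub> (T #> g) = (T #> g) \<otimes>\<^bsub>G Mod T\<^esub> (T #> x)}"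
  have qS: "T #> x \<in> carrier (G Mod T)" if "x \<in> S" for x
    using that assms(2) q.hom_closed by blast
  have "subgroup ?C G"
  proof (rule subgroupI)
    show "?C \<noteq> {}"
      using qS by (auto intro!: exI[of _ \<one>] simp del: mult_FactGroup one_FactGroup)
  next
    fix a assume a: "a \<in> ?C"
    have "(T #> x) \<otimes>\<^bsub>G Mod T\<^esub> (T #> inv a) = (T #> inv a) \<otimes>\<^bsub>G Mod T\<^esub> (T #> x)" if "x \<in> S" for x
    proof -
      have "T #> inv a = inv\<^bsub>G Mod T\<^esub> (T #> a)" using a q.hom_inv by simp
      moreover have "T #> a \<in> carrier (G Mod T)" using a q.hom_closed by blast
      ultimately show ?thesis
        using a that qS[OF that] Q.commute_inv by simp
    qed
    then show "inv a \<in> ?C" using a by simp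
  next
    fix a b assume a: "a \<in> ?C" and b: "b \<in> ?C"
    have "(T #> x) \<otimes>\<^bsub>G Mod T\<^esub> (T #> (a \<otimes> b)) = (T #> (a \<otimes> b)) \<otimes>\<^bsub>G Mod T\<^esub> (T #> x)" if "x \<in> S" for x
    proof -
      have c: "T #> x \<in> carrier (G Mod T)" "T #> a \<in> carrier (G Mod T)" "T #> b \<in> carrier (G Mod T)"
        using that qS a b q.hom_closed by auto
      have "T #> (a \<otimes> b) = (T #> a) \<otimes>\<^bsub>G Mod T\<^esub> (T #> b)" using a b q.hom_mult by simp
      moreover have "(T #> x) \<otimes>\<^bsub>G Mod T\<^esub> (T #> a) = (T #> a) \<otimes>\<^bsub>G Mod T\<^esub> (T #> x)"
        "(T #> x) \<otimes>\<^bsub>G Mod T\<^esub> (T #> b) = (T #> b) \<otimes>\<^bsub>G Mod T\<^esub> (T #> x)"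
        using a b that by auto
      ultimately show ?thesis
        using c by (metis Q.m_assoc)
    qed
    with a b show "a \<otimes> b \<in> ?C" by simp
  qed auto
  moreover have "centralizer_mod S T = ?C"
    using assms commutator_mod_iff[OF assms(1)] by (auto simp: centralizer_mod_def)
  ultimately show ?thesis by simp
qed

lemma normal_centralizer_mod:
  assumes T: "T \<lhd> G" and S: "S \<lhd> G"
  shows "centralizer_mod S T \<lhd> G"
proof -
  interpret T: normal T G by fact
  interpret S: normal S G by fact
  have "h \<otimes> g \<otimes> inv h \<in> centralizer_mod S T" if g: "g \<in> centralizer_mod S T" and h: "h \<in> carrier G" for g h
  proof -
    have gc: "g \<in> carrier G" using g by (simp add: centralizer_mod_def)
    have "commutator x (h \<otimes> g \<otimes> inv h) \<in> T" if x: "x \<in> S" for x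
    proof -
      have xc: "x \<in> carrier G" using x by simp
      have "commutator (inv h \<otimes> x \<otimes> h) g \<in> T"
        using g x h S.inv_op_closed1 by (simp add: centralizer_mod_def)
      then have "h \<otimes> commutator (inv h \<otimes> x \<otimes> h) g \<otimes> inv h \<in> T"
        using h T.inv_op_closed2 by blast
      also have "h \<otimes> commutator (inv h \<otimes> x \<otimes> h) g \<otimes> inv h = commutator x (h \<otimes> g \<otimes> inv h)"
        using gc h xc by (simp add: commutator_def inv_mult_group m_assoc inv_solve_left)
          (simp add: m_assoc[symmetric])
      finally show ?thesis .
    qed
    then show ?thesis using gc h by (simp add: centralizer_mod_def)
  qed
  then show ?thesis
    using subgroup_centralizer_mod[OF T] S.subset by (simp add: normal_inv_iff)
qed

section \<open>Perfect subgroups modulo a normal subgroup\<close>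

text \<open>
  This says \<open>X = [X, G] N\<close>, phrased by a universal property: \<open>[X, G] N\<close> is the least normal subgroup
  \<open>Y \<supseteq> N\<close> modulo which \<open>X\<close> is central.
\<close>

definition perfect_mod :: "'a set \<Rightarrow> 'a set \<Rightarrow> bool" where
  "perfect_mod N X \<longleftrightarrow> X \<lhd> G \<and> N \<subseteq> X \<and>
     (\<forall>Y. Y \<lhd> G \<longrightarrow> N \<subseteq> Y \<longrightarrow> X \<subseteq> centralizer_mod (carrier G) Y \<longrightarrow> X \<subseteq> Y)"

lemma central_mod_iff:
  assumes "T \<lhd> G" "X \<subseteq> carrier G"
  shows "X \<subseteq> centralizer_mod (carrier G) T \<longleftrightarrow> (\<forall>x\<in>X. \<forall>g\<in>carrier G. commutator x g \<in> T)"
proof -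
  interpret T: normal T G by fact
  have "commutator x g \<in> T \<longleftrightarrow> commutator g x \<in> T" if "x \<in> carrier G" "g \<in> carrier G" for x g
    using that inv_commutator by (metis T.m_inv_closed)
  then show ?thesis using assms by (auto simp: centralizer_mod_def)
qed

text \<open>
  Minimal choices below are tested against \<open>Y \<inter> X\<close> in place of \<open>Y\<close>; since \<open>X\<close> is normal, its
  commutators with \<open>G\<close> lie in \<open>X\<close> anyway.
\<close>

lemma central_mod_Int:
  assumes T: "T \<lhd> G" and Y: "Y \<lhd> G" and X: "X \<lhd> G" and "Y \<inter> X \<subseteq> T"
    and "X \<subseteq> centralizer_mod (carrier G) Y"
  shows "X \<subseteq> centralizer_mod (carrier G) T"
proof -
  have "commutator x g \<in> Y \<inter> X" if "x \<in> X" "g \<in> carrier G" for x g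
    using that assms central_mod_iff[OF Y normal_subset_carrier[OF X]] commutator_in_normal[OF X]
      normal_subset_carrier[OF X] by auto
  then show ?thesis
    using assms(4) central_mod_iff[OF T normal_subset_carrier[OF X]] by blast
qed

lemma normal_le_centre_mod:
  assumes "T \<lhd> G" "X \<lhd> G" "X \<subseteq> T"
  shows "X \<subseteq> centralizer_mod (carrier G) T"
  using assms commutator_in_normal[OF assms(1)] normal_subset_carrier[OF assms(2)]
  by (subst central_mod_iff) auto

lemma card_minimal_set:
  assumes "finite (carrier G)" "P X" "\<And>Y. P Y \<Longrightarrow> Y \<subseteq> carrier G"
  obtains Z where "P Z" "\<And>Y. P Y \<Longrightarrow> Y \<subseteq> Z \<Longrightarrow> Y = Z"
proof -
  obtain Z where "P Z" "\<forall>Y. P Y \<longrightarrow> card Z \<le> card Y"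
    using assms(2) ex_has_least_nat[of P X card] by blast
  moreover from this have "finite Z" using assms finite_subset by blast
  ultimately show ?thesis using that card_seteq by metis
qed

text \<open>
  A group without non-trivial perfect normal subgroups behaves like a nilpotent one.  Choose \<open>X\<close> minimal
  above \<open>N\<close> with \<open>G / X L\<close> abelian.  If \<open>X\<close> is central modulo \<open>Y\<close>, put \<open>T = (Y \<inter> X) L\<close>.  Modulo \<open>T\<close> the subgroup \<open>X L\<close> is
  central with abelian quotient, so the centralizer of \<open>v\<close> is normal; it contains \<open>v\<close> and \<open>L\<close> and hence
  everything.  Thus \<open>v\<close> is central modulo \<open>T\<close>, so \<open>G / T\<close> is abelian, and \<open>X \<subseteq> Y\<close> by minimality.  In other
  words, \<open>X\<close> is perfect modulo \<open>N\<close>, which forces \<open>X = N \<subseteq> L\<close>.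
\<close>

lemma commutator_in_of_no_perfect:
  assumes fin: "finite (carrier G)" and N: "N \<lhd> G"
    and nop: "\<And>X. perfect_mod N X \<Longrightarrow> X = N"
    and L: "L \<lhd> G" "N \<subseteq> L" and v: "v \<in> carrier G" and gen: "normal_closure G (insert v L) = carrier G"
    and x: "x \<in> carrier G" and y: "y \<in> carrier G"
  shows "commutator x y \<in> L"
proof -
  define P where "P X \<longleftrightarrow> X \<lhd> G \<and> N \<subseteq> X \<and>
     (\<forall>a\<in>carrier G. \<forall>b\<in>carrier G. commutator a b \<in> normal_closure G (X \<union> L))" for X
  have "P (carrier G)"
    using normal_subset_carrier[OF N] normal_self normal_closure_incl[of "carrier G \<union> L"]
    by (force simp: P_def)
  moreover have "Y \<subseteq> carrier G" if "P Y" for Y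
    using that by (simp add: P_def normal_subset_carrier)
  ultimately obtain X where X: "P X" and X_min: "\<And>Y. P Y \<Longrightarrow> Y \<subseteq> X \<Longrightarrow> Y = X"
    using card_minimal_set[OF fin, of P] by blast
  have Xn: "X \<lhd> G" and NX: "N \<subseteq> X" using X by (auto simp: P_def)
  note Lc = normal_subset_carrier[OF L(1)] and Xc = normal_subset_carrier[OF Xn]
  have "perfect_mod N X"
    unfolding perfect_mod_def
  proof (intro conjI allI impI)
    fix Y assume Y: "Y \<lhd> G" "N \<subseteq> Y" and cen: "X \<subseteq> centralizer_mod (carrier G) Y"
    define T where "T = normal_closure G (Y \<inter> X \<union> L)"
    have T: "T \<lhd> G" unfolding T_def using Xc Lc by (intro normal_closure_normal) auto
    have YT: "Y \<inter> X \<subseteq> T" "L \<subseteq> T" unfolding T_def by (auto intro: normal_closure_memI)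
    have XT: "X \<subseteq> centralizer_mod (carrier G) T"
      by (rule central_mod_Int[OF T Y(1) Xn YT(1) cen])
    have LT: "L \<subseteq> centralizer_mod (carrier G) T"
      using normal_le_centre_mod T L YT by blast
    have Zn: "centralizer_mod (carrier G) T \<lhd> G"
      by (rule normal_centralizer_mod[OF T normal_self])
    define C where "C = centralizer_mod {v} T"
    have Cs: "subgroup C G" unfolding C_def using T v by (intro subgroup_centralizer_mod) auto
    have "centralizer_mod (carrier G) T \<subseteq> C"
      using v by (auto simp: C_def centralizer_mod_def)
    then have XLC: "normal_closure G (X \<union> L) \<subseteq> C"
      using normal_closure_least[OF Zn] XT LT by blast
    \<comment> \<open>\<open>C\<close> contains all commutators, so it is normal.\<close>
    have "C \<lhd> G"
      unfolding normal_inv_iff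
    proof (intro conjI Cs ballI)
      fix h c assume h: "h \<in> carrier G" and c: "c \<in> C"
      then have cc: "c \<in> carrier G" by (simp add: C_def centralizer_mod_def)
      have "commutator h c \<in> C" using X h cc XLC by (auto simp: P_def)
      then have "commutator h c \<otimes> c \<in> C" using c Cs by (simp add: subgroup.m_closed)
      then show "h \<otimes> c \<otimes> inv h \<in> C" using h cc by (simp add: commutator_def m_assoc)
    qed
    moreover have "v \<in> C"
      using v T by (auto simp: C_def centralizer_mod_def commutator_def m_assoc normal_imp_subgroup subgroup.one_closed)
    moreover have "L \<subseteq> C" using XLC normal_closure_incl by blast
    ultimately have "carrier G \<subseteq> C" using normal_closure_least gen by blast
    \<comment> \<open>Modulo \<open>T\<close>, the element \<open>v\<close> commutes with everything, so \<open>G / T\<close> is abelian.\<close>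
    then have "{v} \<subseteq> centralizer_mod (carrier G) T"
      using v T by (subst central_mod_iff) (auto simp: C_def centralizer_mod_def)
    then have "carrier G \<subseteq> centralizer_mod (carrier G) T"
      using normal_closure_least[OF Zn, of "insert v L"] gen LT by auto
    then have "P (Y \<inter> X)"
      using Y(2) NX normal_subgroup_intersect[OF Y(1) Xn] T by (auto simp: P_def T_def[symmetric] central_mod_iff)
    then show "X \<subseteq> Y" using X_min by blast
  qed (use Xn NX in auto)
  then have "X = N" by (rule nop)
  then have "normal_closure G (X \<union> L) \<subseteq> L" using L normal_closure_least by blast
  then show ?thesis using X x y by (auto simp: P_def)
qed

text \<open>
  Take \<open>K\<close> to be the centralizer of a chief factor \<open>X / H\<close> with \<open>N \<subseteq> H\<close>; it is proper because \<open>X\<close>, being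
  perfect modulo \<open>N\<close>, is not central modulo \<open>H\<close>.  If \<open>v \<notin> K\<close> and \<open>V\<close> is the normal closure of \<open>v\<close> and \<open>N\<close>,
  then \<open>X \<inter> V\<close> contains a commutator outside \<open>H\<close>, whence \<open>(X \<inter> V) H = X\<close>.  A minimal normal \<open>Z \<subseteq> X \<inter> V\<close>
  containing \<open>N\<close> with \<open>Z H = X\<close> is again perfect modulo \<open>N\<close>: if \<open>Z\<close> is central modulo \<open>Y\<close>, then \<open>X = Z H\<close> is central
  modulo \<open>(Y \<inter> Z) H\<close> and so equal to it.  Minimality of \<open>X\<close> gives \<open>Z = X\<close>, that is, \<open>X \<subseteq> V\<close>.
\<close>

lemma ex_pivot_kernel:
  assumes fin: "finite (carrier G)" and N: "N \<lhd> G"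
    and X: "perfect_mod N X" "X \<noteq> N"
    and X_min: "\<And>Z. perfect_mod N Z \<Longrightarrow> Z \<noteq> N \<Longrightarrow> Z \<subseteq> X \<Longrightarrow> Z = X"
  obtains K where "K \<lhd> G" "K \<noteq> carrier G"
    "\<And>v. v \<in> carrier G \<Longrightarrow> v \<notin> K \<Longrightarrow> X \<subseteq> normal_closure G (insert v N)"
proof -
  have Xn: "X \<lhd> G" and NX: "N \<subseteq> X"
    and Xp: "\<And>Y. Y \<lhd> G \<Longrightarrow> N \<subseteq> Y \<Longrightarrow> X \<subseteq> centralizer_mod (carrier G) Y \<Longrightarrow> X \<subseteq> Y"
    using X(1) by (auto simp: perfect_mod_def)
  note Nc = normal_subset_carrier[OF N] and Xc = normal_subset_carrier[OF Xn]
  define R where "R H \<longleftrightarrow> H \<lhd> G \<and> N \<subseteq> H \<and> H \<subset> X" for H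
  have "finite (Collect R)"
    using finite_subset[OF Xc fin] by (rule finite_subset[rotated, OF finite_Pow_iff[THEN iffD2]]) (auto simp: R_def)
  moreover have "R N" using N NX X(2) by (auto simp: R_def)
  ultimately obtain H where H: "R H" and H_max: "\<And>H'. R H' \<Longrightarrow> H \<subseteq> H' \<Longrightarrow> H' = H"
    using finite_has_maximal[of "Collect R"] by blast
  have Hn: "H \<lhd> G" and NH: "N \<subseteq> H" and HX: "H \<subset> X" using H by (auto simp: R_def)
  note Hc = normal_subset_carrier[OF Hn]
  define K where "K = centralizer_mod X H"
  have Kn: "K \<lhd> G" unfolding K_def by (rule normal_centralizer_mod[OF Hn Xn])
  show ?thesis
  proof (rule that[OF Kn])
    show "K \<noteq> carrier G"
    proof
      assume "K = carrier G"
      then have "X \<subseteq> centralizer_mod (carrier G) H"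
        using Xc Hn by (subst central_mod_iff) (auto simp: K_def centralizer_mod_def)
      then show False using Xp[OF Hn NH] HX by blast
    qed
  next
    fix v assume v: "v \<in> carrier G" "v \<notin> K"
    define V where "V = normal_closure G (insert v N)"
    have Vn: "V \<lhd> G" unfolding V_def using v Nc by (intro normal_closure_normal) auto
    have V: "v \<in> V" "N \<subseteq> V" unfolding V_def by (auto intro: normal_closure_memI)
    obtain x where x: "x \<in> X" "commutator x v \<notin> H"
      using v by (auto simp: K_def centralizer_mod_def)
    define P where "P Z \<longleftrightarrow> Z \<lhd> G \<and> N \<subseteq> Z \<and> Z \<subseteq> X \<inter> V \<and> X \<subseteq> normal_closure G (Z \<union> H)" for Z
    \<comment> \<open>The commutator of \<open>x\<close> and \<open>v\<close> lies in \<open>X \<inter> V\<close> but not in \<open>H\<close>, which is maximal below \<open>X\<close>.\<close>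
    have "P (X \<inter> V)"
    proof -
      let ?H' = "normal_closure G (X \<inter> V \<union> H)"
      have H'n: "?H' \<lhd> G" using Xc Hc by (intro normal_closure_normal) auto
      have "H \<subseteq> ?H'" "X \<inter> V \<subseteq> ?H'" by (auto intro: normal_closure_memI)
      moreover have "commutator x v \<in> X \<inter> V"
        using x v V Xc commutator_in_normal[OF Xn] commutator_in_normal[OF Vn] by auto
      moreover have "?H' \<subseteq> X" using Xn HX by (intro normal_closure_least) auto
      ultimately have "?H' = X"
        using H_max[of ?H'] x NH H'n unfolding R_def by blast
      then show ?thesis using NX V normal_subgroup_intersect[OF Xn Vn] by (auto simp: P_def)
    qed
    moreover have "Y \<subseteq> carrier G" if "P Y" for Y
      using that by (simp add: P_def normal_subset_carrier)
    ultimately obtain Z where Z: "P Z" and Z_min: "\<And>Y. P Y \<Longrightarrow> Y \<subseteq> Z \<Longrightarrow> Y = Z"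
      using card_minimal_set[OF fin, of P] by blast
    have Zn: "Z \<lhd> G" and NZ: "N \<subseteq> Z" and ZXV: "Z \<subseteq> X" "Z \<subseteq> V" and XZ: "X \<subseteq> normal_closure G (Z \<union> H)"
      using Z by (auto simp: P_def)
    note Zc = normal_subset_carrier[OF Zn]
    have "perfect_mod N Z"
      unfolding perfect_mod_def
    proof (intro conjI allI impI)
      fix Y assume Y: "Y \<lhd> G" "N \<subseteq> Y" and cen: "Z \<subseteq> centralizer_mod (carrier G) Y"
      define T where "T = normal_closure G (Y \<inter> Z \<union> H)"
      have T: "T \<lhd> G" unfolding T_def using Zc Hc by (intro normal_closure_normal) auto
      have YT: "Y \<inter> Z \<subseteq> T" "H \<subseteq> T" unfolding T_def by (auto intro: normal_closure_memI)
      have "Z \<subseteq> centralizer_mod (carrier G) T"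
        by (rule central_mod_Int[OF T Y(1) Zn YT(1) cen])
      moreover have "H \<subseteq> centralizer_mod (carrier G) T"
        using normal_le_centre_mod T Hn YT by blast
      ultimately have "X \<subseteq> centralizer_mod (carrier G) T"
        using XZ normal_closure_least[OF normal_centralizer_mod[OF T normal_self]]
        by (meson Un_least subset_trans)
      then have "X \<subseteq> T" using Xp T YT NH by blast
      then have "P (Y \<inter> Z)"
        using Y(2) NZ ZXV normal_subgroup_intersect[OF Y(1) Zn] by (auto simp: P_def T_def)
      then show "Z \<subseteq> Y" using Z_min by blast
    qed (use Zn NZ in auto)
    moreover have "Z \<noteq> N"
    proof
      assume "Z = N"
      then have "normal_closure G (Z \<union> H) \<subseteq> H" using NH Hn by (intro normal_closure_least) auto
      then show False using XZ HX by blast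
    qed
    ultimately have "Z = X" using X_min ZXV by blast
    then show "X \<subseteq> normal_closure G (insert v N)" using ZXV V_def by simp
  qed
qed

end

section \<open>Andrews--Curtis moves modulo a normal subgroup\<close>

text \<open>
  Only conjugation needs surjectivity: the conjugating element has to be lifted.
\<close>

lemma ac_move_lift:
  assumes "group_hom G H \<phi>" and surj: "\<phi> ` carrier G = carrier H"
    and xs: "set xs \<subseteq> carrier G" and "ac_move H (map \<phi> xs) cs"
  obtains ys where "ac_move G xs ys" "map \<phi> ys = cs"
proof -
  interpret group_hom G H \<phi> by fact
  have c: "xs ! i \<in> carrier G" if "i < length xs" for i using that xs by auto
  show ?thesis using assms(4)
  proof cases
    case (mult_right i j)
    then show ?thesis using c that[OF ac_move.mult_right[of i xs j G]] by (simp add: map_update)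
  next
    case (mult_right_inv i j)
    then show ?thesis using c that[OF ac_move.mult_right_inv[of i xs j G]] by (simp add: map_update)
  next
    case (mult_left i j)
    then show ?thesis using c that[OF ac_move.mult_left[of i xs j G]] by (simp add: map_update)
  next
    case (mult_left_inv i j)
    then show ?thesis using c that[OF ac_move.mult_left_inv[of i xs j G]] by (simp add: map_update)
  next
    case (invert i)
    then show ?thesis using c that[OF ac_move.invert[of i xs G]] by (simp add: map_update)
  next
    case (conjugate i w)
    moreover obtain v where "v \<in> carrier G" "w = \<phi> v" using surj conjugate(3) by blast
    ultimately show ?thesis using c that[OF ac_move.conjugate[of i xs v G]] by (simp add: map_update)
  qed
qed

context group
begin

lemma ac_move_in_normal:
  assumes "ac_move G xs ys" and "M \<lhd> G" and "set xs \<subseteq> M"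
  shows "set ys \<subseteq> M"
proof -
  interpret M: normal M G by fact
  have m: "xs ! i \<in> M" if "i < length xs" for i using that assms(3) by auto
  have *: "set (xs[i := y]) \<subseteq> M" if "y \<in> M" for i y
    using that assms(3) set_update_subset_insert[of xs i y] by auto
  from assms(1) show ?thesis
    by cases (auto intro!: * m M.inv_op_closed1)
qed

lemma ac_move_sym:
  assumes "ac_move G xs ys" and "set xs \<subseteq> carrier G"
  shows "ac_move G ys xs"
proof -
  have c: "xs ! i \<in> carrier G" if "i < length xs" for i using that assms(2) by auto
  from assms(1) show ?thesis
  proof cases
    case (mult_right i j)
    then show ?thesis using c ac_move.mult_right_inv[of i ys j G] by (simp add: m_assoc)
  next
    case (mult_right_inv i j)
    then show ?thesis using c ac_move.mult_right[of i ys j G] by (simp add: m_assoc)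
  next
    case (mult_left i j)
    then show ?thesis using c ac_move.mult_left_inv[of i ys j G] by (simp add: m_assoc[symmetric])
  next
    case (mult_left_inv i j)
    then show ?thesis using c ac_move.mult_left[of i ys j G] by (simp add: m_assoc[symmetric])
  next
    case (invert i)
    then show ?thesis using c ac_move.invert[of i ys G] by simp
  next
    case (conjugate i w)
    have "w \<otimes> (inv w \<otimes> xs ! i \<otimes> w) \<otimes> inv w = xs ! i"
      using c conjugate by (simp add: m_assoc) (simp add: m_assoc[symmetric])
    then show ?thesis using c conjugate ac_move.conjugate[of i ys "inv w" G] by simp
  qed
qed

lemma ac_move_length: "ac_move G xs ys \<Longrightarrow> length ys = length xs"
  by (auto elim: ac_move.cases)

text \<open>
  Modulo \<open>N\<close> a component may also be multiplied by an element of \<open>N\<close>.  Adding these steps to the moves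
  gives the connectedness relation of \<open>G / N\<close> on tuples of \<open>G\<close>, so that \<open>N\<close> can vary within one group
  and one type.
\<close>

inductive ac_step :: "'a set \<Rightarrow> 'a list \<Rightarrow> 'a list \<Rightarrow> bool" for N where
  move: "ac_move G xs ys \<Longrightarrow> ac_step N xs ys"
| shift: "i < length xs \<Longrightarrow> n \<in> N \<Longrightarrow> ac_step N xs (xs[i := n \<otimes> xs ! i])"

abbreviation ac_mod :: "'a set \<Rightarrow> 'a list \<Rightarrow> 'a list \<Rightarrow> bool" where
  "ac_mod N \<equiv> (ac_step N)\<^sup>*\<^sup>*"

lemma ac_step_in_normal:
  assumes "ac_step N xs ys" and "M \<lhd> G" "N \<subseteq> M" and "set xs \<subseteq> M"
  shows "set ys \<subseteq> M"
  using assms(1)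
proof cases
  case move
  then show ?thesis using ac_move_in_normal assms by blast
next
  case (shift i n)
  then have "n \<otimes> xs ! i \<in> M"
    using assms by (meson normal_imp_subgroup nth_mem subgroup.m_closed subsetD)
  then show ?thesis
    using shift assms(4) set_update_subset_insert[of xs i "n \<otimes> xs ! i"] by auto
qed

lemma ac_step_sym:
  assumes "ac_step N xs ys" and N: "N \<lhd> G" and "set xs \<subseteq> carrier G"
  shows "ac_step N ys xs"
  using assms(1)
proof cases
  case move
  then show ?thesis using ac_move_sym assms ac_step.move by blast
next
  case (shift i n)
  interpret N: normal N G by fact
  have "xs ! i \<in> carrier G" using shift assms(3) by auto
  then show ?thesis using shift ac_step.shift[of i ys "inv n" N] by (simp add: m_assoc[symmetric])
qed

lemma ac_mod_in_normal:
  assumes "ac_mod N xs ys" and "M \<lhd> G" "N \<subseteq> M" and "set xs \<subseteq> M"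
  shows "set ys \<subseteq> M"
  using assms(1) by induction (use assms ac_step_in_normal in auto)

lemma ac_mod_carrier:
  assumes "ac_mod N xs ys" and "N \<lhd> G" and "set xs \<subseteq> carrier G"
  shows "set ys \<subseteq> carrier G"
  using ac_mod_in_normal[OF assms(1) normal_self] assms(2,3) normal_subset_carrier by blast

lemma ac_mod_length: "ac_mod N xs ys \<Longrightarrow> length ys = length xs"
  by (induction rule: rtranclp_induct) (auto elim!: ac_step.cases simp: ac_move_length)

lemma ac_mod_sym:
  assumes "ac_mod N xs ys" and N: "N \<lhd> G" and "set xs \<subseteq> carrier G"
  shows "ac_mod N ys xs"
  using assms(1)
proof induction
  case (step ys zs)
  then show ?case
    using ac_step_sym[OF step(2) N] ac_mod_carrier[OF step(1) N assms(3)]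
    by (meson converse_rtranclp_into_rtranclp)
qed auto

lemma ac_mod_normal_closure:
  assumes "ac_mod N xs ys" and N: "N \<lhd> G" and "set xs \<subseteq> carrier G"
  shows "normal_closure G (set ys \<union> N) = normal_closure G (set xs \<union> N)"
proof -
  have *: "normal_closure G (set vs \<union> N) \<subseteq> normal_closure G (set us \<union> N)"
    if "ac_mod N us vs" "set us \<subseteq> carrier G" for us vs
  proof -
    have n: "normal_closure G (set us \<union> N) \<lhd> G"
      using that N normal_subset_carrier by (intro normal_closure_normal) auto
    then show ?thesis
      using ac_mod_in_normal[OF that(1) n] by (intro normal_closure_least) (auto intro: normal_closure_memI)
  qed
  show ?thesis
    using *[OF assms(1,3)] *[OF ac_mod_sym[OF assms] ac_mod_carrier[OF assms]] by blast
qed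

text \<open>
  The elements by which component \<open>i\<close> can be multiplied, whatever its current value, form a normal
  subgroup.  Closure under conjugation by \<open>h\<close> comes from conjugating component \<open>i\<close> by \<open>h\<close>, multiplying,
  and conjugating back; the other components are left alone throughout.
\<close>

lemma ac_mod_mult:
  assumes N: "N \<lhd> G" and xs: "set xs \<subseteq> carrier G" and i: "i < length xs"
    and g: "g \<in> normal_closure G (N \<union> {xs ! j |j. j < length xs \<and> j \<noteq> i})"
  shows "ac_mod N xs (xs[i := g \<otimes> xs ! i])"
proof -
  interpret N: normal N G by fact
  define M where "M = {g \<in> carrier G. \<forall>y\<in>carrier G. ac_mod N (xs[i := y]) (xs[i := g \<otimes> y])}"
  have upd: "set (xs[i := y]) \<subseteq> carrier G" if "y \<in> carrier G" for y
    using that xs set_update_subset_insert[of xs i y] by auto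
  have conj: "ac_mod N (xs[i := y]) (xs[i := inv w \<otimes> y \<otimes> w])" if "w \<in> carrier G" for w y
    using ac_move.conjugate[of i "xs[i := y]" w G] that i by (auto intro: ac_step.move)
  have "subgroup M G"
  proof (rule subgroupI)
    fix a assume a: "a \<in> M"
    have "ac_mod N (xs[i := y]) (xs[i := inv a \<otimes> y])" if y: "y \<in> carrier G" for y
    proof -
      have "ac_mod N (xs[i := inv a \<otimes> y]) (xs[i := a \<otimes> (inv a \<otimes> y)])"
        using a y by (simp add: M_def)
      then have "ac_mod N (xs[i := inv a \<otimes> y]) (xs[i := y])"
        using a y by (simp add: M_def m_assoc[symmetric])
      then show ?thesis using a y ac_mod_sym[OF _ N upd] by (simp add: M_def)
    qed
    then show "inv a \<in> M" using a by (simp add: M_def)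
  next
    fix a b assume "a \<in> M" "b \<in> M"
    then show "a \<otimes> b \<in> M"
      by (auto simp: M_def m_assoc intro: rtranclp_trans[of "ac_step N"])
  qed (auto simp: M_def intro!: exI[of _ \<one>])
  moreover have "h \<otimes> a \<otimes> inv h \<in> M" if h: "h \<in> carrier G" and a: "a \<in> M" for h a
  proof -
    have "ac_mod N (xs[i := y]) (xs[i := h \<otimes> a \<otimes> inv h \<otimes> y])" if y: "y \<in> carrier G" for y
    proof -
      have "ac_mod N (xs[i := y]) (xs[i := inv h \<otimes> y \<otimes> h])"
        by (rule conj[OF h])
      moreover have "ac_mod N (xs[i := inv h \<otimes> y \<otimes> h]) (xs[i := a \<otimes> (inv h \<otimes> y \<otimes> h)])"
        using a h y by (simp add: M_def)
      moreover have "inv (inv h) \<otimes> (a \<otimes> (inv h \<otimes> y \<otimes> h)) \<otimes> inv h = h \<otimes> a \<otimes> inv h \<otimes> y"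
        using a h y by (simp add: M_def m_assoc)
      then have "ac_mod N (xs[i := a \<otimes> (inv h \<otimes> y \<otimes> h)]) (xs[i := h \<otimes> a \<otimes> inv h \<otimes> y])"
        using conj[OF inv_closed[OF h], of "a \<otimes> (inv h \<otimes> y \<otimes> h)"] by metis
      ultimately show ?thesis by (meson rtranclp_trans)
    qed
    then show ?thesis using a h by (simp add: M_def)
  qed
  ultimately have "M \<lhd> G" by (simp add: normal_inv_iff)
  moreover have "N \<subseteq> M"
  proof
    fix n assume n: "n \<in> N"
    have "ac_step N (xs[i := y]) (xs[i := n \<otimes> y])" for y
      using ac_step.shift[of i "xs[i := y]" n N] n i by simp
    then show "n \<in> M" using n by (auto simp: M_def)
  qed
  moreover have "xs ! j \<in> M" if j: "j < length xs" "j \<noteq> i" for j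
  proof -
    have "ac_step N (xs[i := y]) (xs[i := xs ! j \<otimes> y])" for y
      using ac_move.mult_left[of i "xs[i := y]" j G] j i by (auto intro: ac_step.move)
    then show ?thesis using j xs by (auto simp: M_def)
  qed
  ultimately have "normal_closure G (N \<union> {xs ! j |j. j < length xs \<and> j \<noteq> i}) \<subseteq> M"
    by (intro normal_closure_least) auto
  then have "g \<in> M" using g by blast
  moreover have "xs ! i \<in> carrier G" using xs i by auto
  ultimately have "ac_mod N (xs[i := xs ! i]) (xs[i := g \<otimes> xs ! i])"
    unfolding M_def by blast
  then show ?thesis by simp
qed

lemma ac_mod_change:
  assumes N: "N \<lhd> G" and xs: "set xs \<subseteq> carrier G" and i: "i < length xs"
    and X: "X \<lhd> G" "X \<subseteq> normal_closure G (N \<union> {xs ! j |j. j < length xs \<and> j \<noteq> i})"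
    and y: "y \<in> carrier G" "X #> y = X #> xs ! i"
  shows "ac_mod N xs (xs[i := y])"
proof -
  have c: "xs ! i \<in> carrier G" using xs i by auto
  then have "y \<otimes> inv (xs ! i) \<in> X" using y X(1) rcos_eq_iff normal_imp_subgroup by blast
  then have "ac_mod N xs (xs[i := y \<otimes> inv (xs ! i) \<otimes> xs ! i])"
    using X(2) by (intro ac_mod_mult[OF N xs i]) auto
  then show ?thesis using c y by (simp add: m_assoc)
qed

text \<open>
  Components are replaced from left to right.  The invariant \<open>P\<close> carries whatever makes the next
  replacement possible.
\<close>

lemma ac_mod_coordinatewise:
  assumes len: "length cs = length ds" and P: "P cs"
    and step: "\<And>ws i. P ws \<Longrightarrow> length ws = length cs \<Longrightarrow> i < length cs \<Longrightarrow> ws ! i = cs ! i \<Longrightarrow>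
        ac_mod N ws (ws[i := ds ! i]) \<and> P (ws[i := ds ! i])"
  shows "ac_mod N cs ds"
proof -
  have "n \<le> length cs \<Longrightarrow> ac_mod N cs (take n ds @ drop n cs) \<and> P (take n ds @ drop n cs)" for n
  proof (induction n)
    case (Suc n)
    let ?ws = "take n ds @ drop n cs"
    have "?ws[n := ds ! n] = take (Suc n) ds @ drop (Suc n) cs"
      using Suc.prems len
      by (simp add: take_Suc_conv_app_nth list_update_append Cons_nth_drop_Suc[symmetric])
    moreover have "?ws ! n = cs ! n" using Suc.prems len by (simp add: nth_append)
    ultimately show ?case
      using Suc step[of ?ws n] len by (auto intro: rtranclp_trans)
  qed (use P in auto)
  from this[of "length cs"] show ?thesis using len by simp
qed

text \<open>
  A component whose normal closure contains \<open>X\<close> modulo \<open>N\<close> serves as a pivot: it stays fixed while all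
  others are changed within their cosets of \<open>X\<close>.
\<close>

lemma ac_mod_pivot:
  assumes N: "N \<lhd> G" and cs: "set cs \<subseteq> carrier G" and ds: "set ds \<subseteq> carrier G"
    and X: "X \<lhd> G" "X \<subseteq> normal_closure G (insert (cs ! m) N)"
    and m: "m < length cs" "cs ! m = ds ! m"
    and eq: "map ((#>) X) cs = map ((#>) X) ds"
  shows "ac_mod N cs ds"
proof (rule ac_mod_coordinatewise[where P = "\<lambda>ws. ws ! m = cs ! m \<and> set ws \<subseteq> carrier G"])
  show len: "length cs = length ds" using eq map_eq_imp_length_eq by blast
  fix ws i assume ws: "ws ! m = cs ! m \<and> set ws \<subseteq> carrier G" "length ws = length cs"
    and i: "i < length cs" "ws ! i = cs ! i"
  have di: "ds ! i \<in> carrier G" using i len ds by auto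
  have "ac_mod N ws (ws[i := ds ! i])"
  proof (cases "i = m")
    case True
    then show ?thesis using m ws by (metis list_update_id rtranclp.rtrancl_refl)
  next
    case False
    then have "insert (cs ! m) N \<subseteq> N \<union> {ws ! j |j. j < length ws \<and> j \<noteq> i}"
      using ws m by auto
    then have "X \<subseteq> normal_closure G (N \<union> {ws ! j |j. j < length ws \<and> j \<noteq> i})"
      using X(2) normal_closure_mono by blast
    moreover have "X #> ds ! i = X #> ws ! i"
      using eq i len by (metis nth_map)
    ultimately show ?thesis
      using ac_mod_change[OF N _ _ X(1)] ws i di by auto
  qed
  moreover have "set (ws[i := ds ! i]) \<subseteq> carrier G"
    using ws di set_update_subset_insert[of ws i "ds ! i"] by auto
  moreover have "ws[i := ds ! i] ! m = cs ! m"
    using ws m i by (cases "i = m") auto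
  ultimately show "ac_mod N ws (ws[i := ds ! i]) \<and> ws[i := ds ! i] ! m = cs ! m \<and> set (ws[i := ds ! i]) \<subseteq> carrier G"
    by blast
qed (use cs in auto)

text \<open>
  A path modulo \<open>X\<close> becomes a path in \<open>G\<close> at the price of changing its endpoint within the cosets of
  \<open>X\<close>: the moves are lifted from \<open>G / X\<close>, where the additional steps are invisible.
\<close>

lemma ac_mod_lift:
  assumes X: "X \<lhd> G" and xs: "set xs \<subseteq> carrier G" and "ac_mod X xs ys"
  obtains zs where "(ac_move G)\<^sup>*\<^sup>* xs zs" "set zs \<subseteq> carrier G" "map ((#>) X) zs = map ((#>) X) ys"
proof -
  interpret X: normal X G by fact
  interpret Q: group "G Mod X" by (rule X.factorgroup_is_group)
  interpret q: group_hom G "G Mod X" "(#>) X"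
    using X.r_coset_hom_Mod by (simp add: group_hom_def group_hom_axioms_def is_group Q.is_group)
  have surj: "(#>) X ` carrier G = carrier (G Mod X)"
    by (auto simp: FactGroup_def RCOSETS_def)
  have "\<exists>zs. (ac_move G)\<^sup>*\<^sup>* xs zs \<and> set zs \<subseteq> carrier G \<and> map ((#>) X) zs = map ((#>) X) ys"
    using assms(3)
  proof induction
    case base
    then show ?case using xs by blast
  next
    case (step ys ys')
    then obtain zs where zs: "(ac_move G)\<^sup>*\<^sup>* xs zs" "set zs \<subseteq> carrier G" "map ((#>) X) zs = map ((#>) X) ys"
      by blast
    have ys: "set ys \<subseteq> carrier G" using ac_mod_carrier[OF step(1) X xs] .
    from step(2) show ?case
    proof cases
      case move
      then have "ac_move (G Mod X) (map ((#>) X) zs) (map ((#>) X) ys')"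
        using map_ac_move[OF q.group_hom_axioms _ ys] zs by simp
      then obtain zs' where "ac_move G zs zs'" "map ((#>) X) zs' = map ((#>) X) ys'"
        using ac_move_lift[OF q.group_hom_axioms surj zs(2)] by blast
      then show ?thesis
        using zs ac_move_in_normal[OF _ normal_self] by (meson rtranclp.rtrancl_into_rtrancl)
    next
      case (shift i n)
      have "X #> (n \<otimes> ys ! i) = X #> ys ! i"
        using shift ys X.subset by (subst coset_mult_assoc[symmetric]) (auto simp: X.rcos_const)
      then have "map ((#>) X) ys' = map ((#>) X) ys"
        using shift by (simp add: map_update list_update_same_conv)
      then show ?thesis using zs by auto
    qed
  qed
  then show ?thesis using that by blast
qed

lemma ac_moves_imp_ac_mod: "(ac_move G)\<^sup>*\<^sup>* xs ys \<Longrightarrow> ac_mod N xs ys"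
  by (erule rtranclp_mono[THEN predicate2D, rotated]) (auto intro: ac_step.move)

lemma ac_mod_trivial:
  assumes "ac_mod {\<one>} xs ys" and "set xs \<subseteq> carrier G"
  shows "(ac_move G)\<^sup>*\<^sup>* xs ys"
  using assms(1)
proof induction
  case (step ys zs)
  have "set ys \<subseteq> carrier G"
    using ac_mod_carrier[OF step(1) _ assms(2)] one_is_normal by blast
  then have "ac_move G ys zs \<or> zs = ys"
    using step(2) by (auto elim!: ac_step.cases simp: subset_iff)
  then show ?case using step by auto
qed auto

section \<open>Tuples congruent modulo the derived subgroup\<close>

text \<open>
  A pivot of \<open>cs\<close>, say component \<open>i\<close>, allows all other components to be adjusted to those of \<open>ds\<close>; only
  component \<open>i\<close> remains wrong.  It can be corrected if \<open>ds\<close> has a pivot elsewhere.  If not, then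
  \<open>ds ! i\<close> is the only pivot of \<open>ds\<close>, and some other component \<open>ds ! m\<close>, which lies in \<open>K\<close>, is temporarily
  multiplied by \<open>cs ! i\<close>.  This makes it a pivot; component \<open>i\<close> is corrected, and the multiplication
  is undone up to an element of \<open>X\<close>, which the new pivot \<open>ds ! i\<close> absorbs.
\<close>

lemma ac_mod_of_outside_pivot:
  assumes N: "N \<lhd> G" and X: "X \<lhd> G" and K: "K \<lhd> G"
    and pivot: "\<And>v. v \<in> carrier G \<Longrightarrow> v \<notin> K \<Longrightarrow> X \<subseteq> normal_closure G (insert v N)"
    and cs: "set cs \<subseteq> carrier G" "\<not> set cs \<subseteq> K" and ds: "set ds \<subseteq> carrier G" "\<not> set ds \<subseteq> K"
    and len: "2 \<le> length cs" and eq: "map ((#>) X) cs = map ((#>) X) ds"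
  shows "ac_mod N cs ds"
proof -
  interpret K: normal K G by fact
  interpret X: normal X G by fact
  have l: "length ds = length cs" using eq map_eq_imp_length_eq by metis
  have cc: "cs ! j \<in> carrier G" "ds ! j \<in> carrier G" "X #> cs ! j = X #> ds ! j" if "j < length cs" for j
    using that cs(1) ds(1) l arg_cong[OF eq, of "\<lambda>xs. xs ! j"] by (auto simp: subset_iff)
  obtain i where i: "i < length cs" "cs ! i \<notin> K"
    using cs(2) by (metis in_set_conv_nth subsetI)
  define us where "us = ds[i := cs ! i]"
  have us: "set us \<subseteq> carrier G"
    using cc(1)[OF i(1)] ds(1) set_update_subset_insert[of ds i "cs ! i"] by (auto simp: us_def)
  have usX: "map ((#>) X) us = map ((#>) X) ds"
    using cc(3)[OF i(1)] i l by (simp add: us_def map_update list_update_same_conv)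
  have "ac_mod N cs us"
    by (rule ac_mod_pivot[OF N cs(1) us X pivot, of i]) (use i cc usX eq l in \<open>auto simp: us_def\<close>)
  moreover have "ac_mod N us ds"
  proof (cases "\<exists>m<length cs. m \<noteq> i \<and> ds ! m \<notin> K")
    case True
    then obtain m where "m < length cs" "m \<noteq> i" "ds ! m \<notin> K" by blast
    then show ?thesis
      by (intro ac_mod_pivot[OF N us ds(1) X pivot, of m]) (use i cc usX l in \<open>auto simp: us_def\<close>)
  next
    case False
    then have di: "ds ! i \<notin> K" using ds(2) l by (auto simp: in_set_conv_nth)
    obtain m where m: "m < length cs" "m \<noteq> i"
      using len that[of 0] that[of 1] by fastforce
    then have dm: "ds ! m \<in> K" using False by blast
    define ws where "ws = us[m := ds ! m \<otimes> cs ! i]"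
    define vs where "vs = ws[i := ds ! i]"
    define ts where "ts = ds[m := ds ! m \<otimes> cs ! i \<otimes> inv (ds ! i)]"
    note c = cc[OF i(1)] cc[OF m(1)]
    have upd: "set (xs[j := y]) \<subseteq> carrier G" if "set xs \<subseteq> carrier G" "y \<in> carrier G" for xs j y
      using that set_update_subset_insert[of xs j y] by auto
    have "ac_mod N us ws"
      using ac_move.mult_right[of m us i G] m i l
      by (auto simp: us_def ws_def intro!: r_into_rtranclp ac_step.move)
    moreover have "ac_mod N ws vs"
    proof (rule ac_mod_pivot[OF N _ _ X pivot, of _ _ m])
      have "ds ! m \<otimes> cs ! i \<notin> K"
      proof
        assume "ds ! m \<otimes> cs ! i \<in> K"
        then have "inv (ds ! m) \<otimes> (ds ! m \<otimes> cs ! i) \<in> K" using dm by blast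
        then show False using c i by (simp add: m_assoc[symmetric])
      qed
      then show "ws ! m \<notin> K" using m l by (simp add: ws_def us_def)
      have "ws ! i = cs ! i" "i < length ws" using m i l by (simp_all add: ws_def us_def)
      then show "map ((#>) X) ws = map ((#>) X) vs"
        using c by (intro sym[of "map ((#>) X) vs"]) (simp add: vs_def map_update list_update_same_conv)
    qed (use m i l us upd c in \<open>auto simp: vs_def ws_def us_def\<close>)
    moreover have "ac_mod N vs ts"
    proof -
      have "vs = ds[m := ds ! m \<otimes> cs ! i]"
        using m i l by (simp add: vs_def ws_def us_def list_update_swap)
      then show ?thesis
        using ac_move.mult_right_inv[of m vs i G] m i l
        by (auto simp: ts_def intro!: r_into_rtranclp ac_step.move)
    qed
    moreover have "ac_mod N ts ds"
    proof (rule ac_mod_pivot[OF N _ ds(1) X pivot, of _ i])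
      have "X #> (ds ! m \<otimes> cs ! i \<otimes> inv (ds ! i)) = (X #> ds ! m) <#> ((X #> cs ! i) <#> (X #> inv (ds ! i)))"
        using c(1,2,5) by (simp add: X.rcos_sum m_assoc)
      also have "\<dots> = (X #> ds ! m) <#> ((X #> ds ! i) <#> (X #> inv (ds ! i)))"
        by (simp only: c)
      also have "\<dots> = X #> ds ! m"
        using c(2,5) by (simp add: X.rcos_sum)
      finally show "map ((#>) X) ts = map ((#>) X) ds"
        using m l by (simp add: ts_def map_update list_update_same_conv)
    qed (use m i l upd ds(1) di c in \<open>auto simp: ts_def\<close>)
    ultimately show ?thesis by (meson rtranclp_trans)
  qed
  ultimately show ?thesis by (rule rtranclp_trans)
qed

lemma commutator_in_derived:
  "x \<in> carrier G \<Longrightarrow> y \<in> carrier G \<Longrightarrow> commutator x y \<in> derived G (carrier G)"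
  unfolding derived_def commutator_def by (rule generate.incl) blast

lemma derived_least:
  assumes "L \<lhd> G" and "\<And>x y. x \<in> carrier G \<Longrightarrow> y \<in> carrier G \<Longrightarrow> commutator x y \<in> L"
  shows "derived G (carrier G) \<subseteq> L"
  unfolding derived_def using assms
  by (intro generate_subgroup_incl) (auto simp: commutator_def normal_imp_subgroup)

text \<open>
  By lemma \<open>commutator_in_of_no_perfect\<close>, the normal closure of \<open>N\<close> and all components but one contains the derived
  subgroup, and this persists along the way because moves preserve the normal closure of the tuple.
\<close>

lemma ac_mod_of_no_perfect:
  assumes fin: "finite (carrier G)" and N: "N \<lhd> G"
    and nop: "\<And>X. perfect_mod N X \<Longrightarrow> X = N"
    and cs: "set cs \<subseteq> carrier G" "normal_closure G (set cs \<union> N) = carrier G"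
    and ds: "set ds \<subseteq> carrier G"
    and eq: "map ((#>) (derived G (carrier G))) cs = map ((#>) (derived G (carrier G))) ds"
  shows "ac_mod N cs ds"
proof (rule ac_mod_coordinatewise[where
      P = "\<lambda>ws. set ws \<subseteq> carrier G \<and> normal_closure G (set ws \<union> N) = carrier G"])
  show len: "length cs = length ds" using eq map_eq_imp_length_eq by blast
  fix ws i assume ws: "set ws \<subseteq> carrier G \<and> normal_closure G (set ws \<union> N) = carrier G" "length ws = length cs"
    and i: "i < length cs" "ws ! i = cs ! i"
  have di: "ds ! i \<in> carrier G" "ws ! i \<in> carrier G" using i(1) len ds ws nth_mem[of i ws] by auto
  define S where "S = N \<union> {ws ! j |j. j < length ws \<and> j \<noteq> i}"
  define L where "L = normal_closure G S"
  have L: "L \<lhd> G"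
    unfolding L_def S_def using ws normal_subset_carrier[OF N] by (intro normal_closure_normal) auto
  have S: "S \<subseteq> L" unfolding L_def by (rule normal_closure_incl)
  have NL: "N \<subseteq> L" using S by (auto simp: S_def)
  have "set ws \<subseteq> insert (ws ! i) S" by (auto simp: in_set_conv_nth S_def)
  then have "set ws \<union> N \<subseteq> insert (ws ! i) L" using S NL by blast
  then have "carrier G \<subseteq> normal_closure G (insert (ws ! i) L)"
    using ws normal_closure_mono[of "set ws \<union> N" "insert (ws ! i) L"] by simp
  moreover have "normal_closure G (insert (ws ! i) L) \<subseteq> carrier G"
    using di normal_subset_carrier[OF L] by (intro normal_closure_least[OF normal_self]) auto
  ultimately have gen: "normal_closure G (insert (ws ! i) L) = carrier G"
    by (rule equalityI[rotated])
  have "derived G (carrier G) \<subseteq> L"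
    by (rule derived_least[OF L commutator_in_of_no_perfect[OF fin N nop L NL di(2) gen]])
  moreover have "derived G (carrier G) #> ds ! i = derived G (carrier G) #> ws ! i"
    using arg_cong[OF eq, of "\<lambda>xs. xs ! i"] i len by simp
  ultimately have *: "ac_mod N ws (ws[i := ds ! i])"
    using ws i di unfolding L_def S_def
    by (intro ac_mod_change[OF N _ _ derived_self_is_normal]) auto
  then show "ac_mod N ws (ws[i := ds ! i]) \<and> set (ws[i := ds ! i]) \<subseteq> carrier G \<and>
      normal_closure G (set (ws[i := ds ! i]) \<union> N) = carrier G"
    using ac_mod_normal_closure[OF * N] ac_mod_carrier[OF * N] ws by simp
qed (use cs in auto)

lemma ac_moves_normally_generating:
  assumes "(ac_move G)\<^sup>*\<^sup>* xs ys" and xs: "xs \<in> normally_generating k G"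
  shows "ys \<in> normally_generating k G"
proof -
  have m: "ac_mod {\<one>} xs ys" using assms(1) by (rule ac_moves_imp_ac_mod)
  have c: "set xs \<subseteq> carrier G" using xs by (simp add: normally_generating_def)
  have "normal_closure G (set zs \<union> {\<one>}) = normal_closure G (set zs)" if "set zs \<subseteq> carrier G" for zs
    using normal_closure_normal[OF that] normal_closure_incl[of "set zs"]
    by (intro equalityI normal_closure_least normal_closure_mono)
      (auto simp: normal_imp_subgroup subgroup.one_closed)
  then show ?thesis
    using xs m c ac_mod_length[OF m] ac_mod_carrier[OF m one_is_normal c] ac_mod_normal_closure[OF m one_is_normal c]
    by (simp add: normally_generating_def)
qed

text \<open>
  The statement for a larger \<open>X\<close> yields a path from \<open>cs\<close> to some
  \<open>es \<equiv> ds\<close> modulo \<open>X\<close>.  Since \<open>es\<close> is reached by genuine moves, it normally generates \<open>G\<close>; this is what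
  provides it with a pivot, and it may fail for the intermediate tuples of a path modulo \<open>X\<close>.
\<close>

lemma ac_mod_of_derived_eq:
  assumes fin: "finite (carrier G)" and k: "2 \<le> k" and N: "N \<lhd> G"
    and cs: "cs \<in> normally_generating k G" and ds: "ds \<in> normally_generating k G"
    and eq: "map ((#>) (derived G (carrier G))) cs = map ((#>) (derived G (carrier G))) ds"
  shows "ac_mod N cs ds"
  using N
proof (induction "card (carrier G) - card N" arbitrary: N rule: less_induct)
  case less
  note N = \<open>N \<lhd> G\<close>
  note Nc = normal_subset_carrier[OF N]
  have c: "set cs \<subseteq> carrier G" "set ds \<subseteq> carrier G"
    using cs ds by (auto simp: normally_generating_def)
  show ?case
  proof (cases "\<exists>X. perfect_mod N X \<and> X \<noteq> N")
    case False
    have "carrier G \<subseteq> normal_closure G (set cs \<union> N)"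
      using cs normal_closure_mono[of "set cs" "set cs \<union> N"] by (auto simp: normally_generating_def)
    moreover have "normal_closure G (set cs \<union> N) \<subseteq> carrier G"
      using c Nc by (intro normal_closure_least[OF normal_self]) auto
    ultimately have "normal_closure G (set cs \<union> N) = carrier G" by blast
    then show ?thesis using ac_mod_of_no_perfect[OF fin N _ c(1) _ c(2) eq] False by blast
  next
    case True
    define P where "P X \<longleftrightarrow> perfect_mod N X \<and> X \<noteq> N" for X
    have "\<exists>X. P X" using True by (simp add: P_def)
    moreover have "Y \<subseteq> carrier G" if "P Y" for Y
      using that normal_subset_carrier by (auto simp: P_def perfect_mod_def)
    ultimately obtain X where "P X" "\<And>Z. P Z \<Longrightarrow> Z \<subseteq> X \<Longrightarrow> Z = X"
      using card_minimal_set[OF fin, of P] by blast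
    then have X: "perfect_mod N X" "X \<noteq> N"
      and X_min: "\<And>Z. perfect_mod N Z \<Longrightarrow> Z \<noteq> N \<Longrightarrow> Z \<subseteq> X \<Longrightarrow> Z = X"
      by (simp_all add: P_def)
    have Xn: "X \<lhd> G" and NX: "N \<subset> X" using X by (auto simp: perfect_mod_def)
    have "card N < card X" "card X \<le> card (carrier G)"
      using NX normal_subset_carrier[OF Xn] fin by (auto intro: psubset_card_mono card_mono finite_subset)
    then have "ac_mod X cs ds" using less(1)[OF _ Xn] by simp
    then obtain es where es: "(ac_move G)\<^sup>*\<^sup>* cs es" "set es \<subseteq> carrier G" "map ((#>) X) es = map ((#>) X) ds"
      using ac_mod_lift[OF Xn c(1)] by blast
    have esg: "es \<in> normally_generating k G" using ac_moves_normally_generating[OF es(1) cs] .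
    obtain K where K: "K \<lhd> G" "K \<noteq> carrier G"
      "\<And>v. v \<in> carrier G \<Longrightarrow> v \<notin> K \<Longrightarrow> X \<subseteq> normal_closure G (insert v N)"
      using ex_pivot_kernel[OF fin N X X_min] by blast
    have nK: "\<not> set xs \<subseteq> K" if "xs \<in> normally_generating k G" for xs
      using that normal_closure_least[OF K(1), of "set xs"] K(2) normal_subset_carrier[OF K(1)]
      by (auto simp: normally_generating_def)
    have "2 \<le> length es" using esg k by (simp add: normally_generating_def)
    then have "ac_mod N es ds"
      by (intro ac_mod_of_outside_pivot[OF N Xn K(1) K(3) es(2) nK[OF esg] c(2) nK[OF ds] _ es(3)])
    then show ?thesis using ac_moves_imp_ac_mod[OF es(1)] by (meson rtranclp_trans)
  qed
qed

lemma ac_moves_of_derived_eq: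
  assumes "finite (carrier G)" and "2 \<le> k"
    and "cs \<in> normally_generating k G" and "ds \<in> normally_generating k G"
    and "map ((#>) (derived G (carrier G))) cs = map ((#>) (derived G (carrier G))) ds"
  shows "(ac_move G)\<^sup>*\<^sup>* cs ds"
  using ac_mod_of_derived_eq[OF assms(1,2) one_is_normal assms(3,4,5)] assms(3)
  by (intro ac_mod_trivial) (auto simp: normally_generating_def)

section \<open>The Euclidean algorithm on exponent vectors\<close>

lemma additive_int_simps:
  fixes f :: "'a \<Rightarrow> int"
  assumes "\<And>x y. x \<in> carrier G \<Longrightarrow> y \<in> carrier G \<Longrightarrow> f (x \<otimes> y) = f x + f y"
  shows "f \<one> = 0" and "x \<in> carrier G \<Longrightarrow> f (inv x) = - f x"
    and "x \<in> carrier G \<Longrightarrow> f (x [^] (n :: int)) = n * f x"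
proof -
  show 1: "f \<one> = 0" using assms[of \<one> \<one>] by simp
  have i: "f (inv x) = - f x" if "x \<in> carrier G" for x
    using assms[of x "inv x"] that 1 by simp
  then show "x \<in> carrier G \<Longrightarrow> f (inv x) = - f x" .
  have p: "f (x [^] m) = int m * f x" if "x \<in> carrier G" for x and m :: nat
    using that by (induction m) (simp_all add: 1 assms algebra_simps)
  show "x \<in> carrier G \<Longrightarrow> f (x [^] (n :: int)) = n * f x"
    by (cases n rule: int_cases2) (simp_all add: p int_pow_int int_pow_neg_int i)
qed

text \<open>
  Conjugates are indistinguishable in an abelian group, so normal generation amounts to generation
  there.
\<close>

lemma span_of_normally_generating:
  fixes e :: "nat \<Rightarrow> 'a \<Rightarrow> int"
  assumes add: "\<And>j x y. x \<in> carrier G \<Longrightarrow> y \<in> carrier G \<Longrightarrow> e j (x \<otimes> y) = e j x + e j y"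
    and us: "us \<in> normally_generating k G" and x: "x \<in> carrier G"
  shows "\<exists>c. \<forall>j. e j x = (\<Sum>i<k. c i * e j (us ! i))"
proof -
  define M where "M = {x \<in> carrier G. \<exists>c. \<forall>j. e j x = (\<Sum>i<k. c i * e j (us ! i))}"
  note e = additive_int_simps[of "e j" for j, OF add]
  have len: "length us = k" and c: "set us \<subseteq> carrier G" and gen: "normal_closure G (set us) = carrier G"
    using us by (auto simp: normally_generating_def)
  have "subgroup M G"
  proof (rule subgroupI)
    have "\<one> \<in> M" using e(1) by (auto simp: M_def intro!: exI[of _ "\<lambda>_. 0"])
    then show "M \<noteq> {}" by blast
  next
    fix a assume "a \<in> M"
    then obtain c where c: "a \<in> carrier G" "\<forall>j. e j a = (\<Sum>i<k. c i * e j (us ! i))"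
      by (auto simp: M_def)
    then have "\<forall>j. e j (inv a) = (\<Sum>i<k. - c i * e j (us ! i))"
      by (simp add: e(2) sum_negf)
    then show "inv a \<in> M" using c unfolding M_def
      by (intro CollectI conjI exI[of _ "\<lambda>i. - c i"]) auto
  next
    fix a b assume "a \<in> M" "b \<in> M"
    then obtain c d where c: "a \<in> carrier G" "\<forall>j. e j a = (\<Sum>i<k. c i * e j (us ! i))"
      and d: "b \<in> carrier G" "\<forall>j. e j b = (\<Sum>i<k. d i * e j (us ! i))"
      by (auto simp: M_def)
    then have "\<forall>j. e j (a \<otimes> b) = (\<Sum>i<k. (c i + d i) * e j (us ! i))"
      by (simp add: add sum.distrib algebra_simps)
    then show "a \<otimes> b \<in> M" using c d unfolding M_def
      by (intro CollectI conjI exI[of _ "\<lambda>i. c i + d i"]) auto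
  qed (auto simp: M_def)
  moreover have "h \<otimes> a \<otimes> inv h \<in> M" if "h \<in> carrier G" "a \<in> M" for h a
  proof -
    have "a \<in> carrier G" using that by (simp add: M_def)
    then have "e j (h \<otimes> a \<otimes> inv h) = e j a" for j
      using that by (simp add: add e)
    then show ?thesis using that by (simp add: M_def)
  qed
  ultimately have "M \<lhd> G" by (simp add: normal_inv_iff)
  moreover have "set us \<subseteq> M"
  proof
    fix u assume u: "u \<in> set us"
    then obtain i where i: "i < k" "u = us ! i" using len by (auto simp: in_set_conv_nth)
    have "e j u = (\<Sum>l<k. (if l = i then 1 else 0) * e j (us ! l))" for j
      using i by (simp add: if_distrib[of "\<lambda>x. x * _"] cong: if_cong)
    then show "u \<in> M" using u c unfolding M_def
      by (intro CollectI conjI exI[of _ "\<lambda>l. if l = i then 1 else 0"]) auto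
  qed
  ultimately have "carrier G \<subseteq> M" using normal_closure_least gen by metis
  then show ?thesis using x by (auto simp: M_def)
qed

text \<open>
  Column \<open>m\<close> of the integer matrix \<open>e j (us ! i)\<close> is cleared, the earlier columns being standard already.
  Among all reachable tuples that keep the earlier columns, one with least sum of absolute values of the
  entries in column \<open>m\<close> and rows \<open>m, \<dots>, k - 1\<close> has at most one non-zero entry there, since otherwise
  adding or subtracting a row with a smaller entry would decrease the sum.  The rows span a vector
  that vanishes in the earlier columns and is \<open>1\<close> in column \<open>m\<close>; the earlier rows cannot contribute to it,
  so the surviving entry is a unit.  It is copied to row \<open>m\<close>, made \<open>1\<close>, and used to clear the other rows.
\<close>

lemma ac_moves_clear_column:
  fixes e :: "nat \<Rightarrow> 'a \<Rightarrow> int"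
  defines "clean \<equiv> \<lambda>m k ws. \<forall>i<k. \<forall>j<m. e j (ws ! i) = (if i = j then 1 else 0)"
  assumes add: "\<And>j x y. x \<in> carrier G \<Longrightarrow> y \<in> carrier G \<Longrightarrow> e j (x \<otimes> y) = e j x + e j y"
    and x: "x \<in> carrier G" "\<And>j. j < k \<Longrightarrow> e j x = (if j = m then 1 else 0)"
    and us: "us \<in> normally_generating k G" and m: "m < k" and cl: "clean m k us"
  shows "\<exists>vs. (ac_move G)\<^sup>*\<^sup>* us vs \<and> clean (Suc m) k vs"
proof -
  note e = additive_int_simps[of "e j" for j, OF add]
  define R where "R ws \<longleftrightarrow> (ac_move G)\<^sup>*\<^sup>* us ws \<and> clean m k ws" for ws
  define \<mu> where "\<mu> ws = (\<Sum>i\<in>{m..<k}. nat \<bar>e m (ws ! i)\<bar>)" for ws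
  have "R us" using cl by (simp add: R_def)
  then obtain ws where ws: "R ws" and min: "\<And>vs. R vs \<Longrightarrow> \<mu> ws \<le> \<mu> vs"
    using ex_has_least_nat[of R us \<mu>] by blast
  have R_ng: "vs \<in> normally_generating k G" if "R vs" for vs
    using ac_moves_normally_generating[OF _ us] that by (auto simp: R_def)
  have R_len: "length vs = k" and R_c: "i < k \<Longrightarrow> vs ! i \<in> carrier G" if "R vs" for vs i
    using R_ng[OF that] by (auto simp: normally_generating_def)
  have R_cl: "e j (vs ! i) = (if i = j then 1 else 0)" if "R vs" "i < k" "j < m" for vs i j
    using that by (simp add: R_def clean_def)
  have R_upd: "R (vs[i := y])"
    if "R vs" "i < k" "ac_move G vs (vs[i := y])" "\<And>j. j < m \<Longrightarrow> e j y = e j (vs ! i)" for vs i y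
    using that R_len[OF that(1)] unfolding R_def clean_def
    by (auto simp: nth_list_update intro: rtranclp.rtrancl_into_rtrancl)
  have red: False
    if p: "p \<in> {m..<k}" and q: "q \<in> {m..<k}" and pq: "p \<noteq> q" "\<bar>e m (ws ! p)\<bar> \<le> \<bar>e m (ws ! q)\<bar>" "e m (ws ! p) \<noteq> 0"
    for p q
  proof -
    have c: "ws ! p \<in> carrier G" "ws ! q \<in> carrier G" using p q R_c[OF ws] by auto
    \<comment> \<open>The sign is chosen so that the entry of row \<open>q\<close> moves towards zero.\<close>
    define y where "y = ws ! q \<otimes> (if (e m (ws ! p) > 0) = (e m (ws ! q) > 0) then inv (ws ! p) else ws ! p)"
    have "ac_move G ws (ws[q := y])"
      using ac_move.mult_right[of q ws p G] ac_move.mult_right_inv[of q ws p G] p q pq R_len[OF ws]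
      by (auto simp: y_def)
    moreover have "e j y = e j (ws ! q)" if "j < m" for j
      using that c p R_cl[OF ws, of p j] by (auto simp: y_def add e)
    ultimately have "R (ws[q := y])" using R_upd[OF ws] q by auto
    then have "\<mu> ws \<le> \<mu> (ws[q := y])" by (rule min)
    moreover have "\<mu> (ws[q := y]) < \<mu> ws"
      unfolding \<mu>_def
    proof (rule sum_strict_mono_ex1)
      have less: "\<bar>e m y\<bar> < \<bar>e m (ws ! q)\<bar>"
        using c pq by (auto simp: y_def add e)
      show "\<forall>i\<in>{m..<k}. nat \<bar>e m (ws[q := y] ! i)\<bar> \<le> nat \<bar>e m (ws ! i)\<bar>"
      proof
        fix i assume "i \<in> {m..<k}"
        then show "nat \<bar>e m (ws[q := y] ! i)\<bar> \<le> nat \<bar>e m (ws ! i)\<bar>"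
          using R_len[OF ws] less by (cases "i = q") auto
      qed
      show "\<exists>i\<in>{m..<k}. nat \<bar>e m (ws[q := y] ! i)\<bar> < nat \<bar>e m (ws ! i)\<bar>"
        using less q R_len[OF ws] by (intro bexI[of _ q]) auto
    qed simp
    ultimately show False by simp
  qed
  have uniq: "e m (ws ! q) = 0" if "p \<in> {m..<k}" "q \<in> {m..<k}" "p \<noteq> q" "e m (ws ! p) \<noteq> 0" for p q
    using red[of p q] red[of q p] that
    by (cases "\<bar>e m (ws ! p)\<bar> \<le> \<bar>e m (ws ! q)\<bar>") auto
  obtain c where c: "\<And>j. e j x = (\<Sum>i<k. c i * e j (ws ! i))"
    using span_of_normally_generating[of e, OF add R_ng[OF ws] x(1)] by auto
  \<comment> \<open>Column \<open>j\<close> of the spanning relation reads \<open>c j = 0\<close>, because that column is standard.\<close>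
  have c0: "c j = 0" if "j < m" for j
  proof -
    have "(\<Sum>i<k. c i * e j (ws ! i)) = (\<Sum>i<k. if i = j then c i else 0)"
      using R_cl[OF ws _ that] by (intro sum.cong) auto
    also have "\<dots> = c j" using that m by simp
    finally show ?thesis using c[of j] x(2)[of j] that m by simp
  qed
  have cm: "(\<Sum>i<k. c i * e m (ws ! i)) = 1" using c[of m] x(2)[OF m] by simp
  have "\<exists>r\<in>{m..<k}. e m (ws ! r) \<noteq> 0"
  proof (rule ccontr)
    assume "\<not> ?thesis"
    then have "c i * e m (ws ! i) = 0" if "i < k" for i
      using that c0[of i] by (cases "i < m") auto
    then have "(\<Sum>i<k. c i * e m (ws ! i)) = 0" by (intro sum.neutral) blast
    then show False using cm by simp
  qed
  then obtain r where r: "r \<in> {m..<k}" "e m (ws ! r) \<noteq> 0" by blast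
  have "(\<Sum>i<k. c i * e m (ws ! i)) = (\<Sum>i<k. if i = r then c i * e m (ws ! i) else 0)"
  proof (intro sum.cong refl)
    fix i assume "i \<in> {..<k}"
    then show "c i * e m (ws ! i) = (if i = r then c i * e m (ws ! i) else 0)"
      using c0[of i] uniq[of r i] r by (cases "i < m") auto
  qed
  then have "c r * e m (ws ! r) = 1" using cm r by simp
  then have unit: "e m (ws ! r) = 1 \<or> e m (ws ! r) = -1" by (auto simp: zmult_eq_1_iff)
  obtain vs where vs: "R vs" "e m (vs ! m) = 1 \<or> e m (vs ! m) = -1"
  proof (cases "r = m")
    case True
    then show ?thesis using that[OF ws] unit by simp
  next
    case False
    have cc: "ws ! r \<in> carrier G" "ws ! m \<in> carrier G" using R_c[OF ws] r m by auto
    have "ac_move G ws (ws[m := ws ! m \<otimes> ws ! r])"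
      using ac_move.mult_right[of m ws r G] False r m R_len[OF ws] by auto
    moreover have "e j (ws ! m \<otimes> ws ! r) = e j (ws ! m)" if "j < m" for j
      using R_cl[OF ws, of r j] that r cc by (simp add: add)
    ultimately have "R (ws[m := ws ! m \<otimes> ws ! r])" by (rule R_upd[OF ws m])
    moreover have "e m (ws ! m) = 0" using uniq[of r m] r m False by auto
    ultimately show ?thesis using that unit cc m R_len[OF ws] by (auto simp: add)
  qed
  obtain vs where vs: "R vs" "e m (vs ! m) = 1"
  proof (cases "e m (vs ! m) = 1")
    case True
    then show ?thesis using that vs by blast
  next
    case False
    have cc: "vs ! m \<in> carrier G" using R_c[OF vs(1)] m by auto
    have "ac_move G vs (vs[m := inv (vs ! m)])"
      using ac_move.invert[of m vs G] m R_len[OF vs(1)] by auto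
    moreover have "e j (inv (vs ! m)) = e j (vs ! m)" if "j < m" for j
      using R_cl[OF vs(1) m that] that cc by (simp add: e)
    ultimately have "R (vs[m := inv (vs ! m)])" by (rule R_upd[OF vs(1) m])
    then show ?thesis using that vs(2) False cc m R_len[OF vs(1)] by (auto simp: e)
  qed
  define ds where "ds = map (\<lambda>i. if i = m then vs ! m else (vs ! m) [^] (- e m (vs ! i)) \<otimes> vs ! i) [0..<k]"
  have cc: "vs ! i \<in> carrier G" if "i < k" for i using R_c[OF vs(1) that] .
  have len: "length vs = k" using R_len[OF vs(1)] .
  \<comment> \<open>The new tuple differs from \<open>vs\<close> by powers of its \<open>m\<close>-th component, which acts as pivot.\<close>
  define X where "X = normal_closure G {vs ! m}"
  have X: "X \<lhd> G" unfolding X_def using cc[OF m] by (intro normal_closure_normal) simp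
  interpret X: normal X G by (rule X)
  have vX: "(vs ! m) [^] n \<in> X" for n :: int
  proof -
    have "vs ! m \<in> X" unfolding X_def by (auto intro: normal_closure_memI)
    then show ?thesis using subgroup_int_pow_closed[OF X.subgroup_axioms] by blast
  qed
  have dc: "set ds \<subseteq> carrier G" using cc m by (auto simp: ds_def)
  have "ac_mod {\<one>} vs ds"
  proof (rule ac_mod_pivot[OF one_is_normal _ dc X])
    show "X \<subseteq> normal_closure G (insert (vs ! m) {\<one>})"
      unfolding X_def by (rule normal_closure_mono) simp
    show "set vs \<subseteq> carrier G" using R_ng[OF vs(1)] by (simp add: normally_generating_def)
    show "map ((#>) X) vs = map ((#>) X) ds"
    proof (rule nth_equalityI)
      fix i assume "i < length (map ((#>) X) vs)"
      then have i: "i < k" using len by simp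
      have "X #> ((vs ! m) [^] (- e m (vs ! i)) \<otimes> vs ! i) = X #> vs ! i"
        using X.rcos_const[OF is_group vX] i cc m X.subset
        by (subst coset_mult_assoc[symmetric]) auto
      then show "map ((#>) X) vs ! i = map ((#>) X) ds ! i"
        using i len by (simp add: ds_def)
    qed (simp add: ds_def len)
  qed (use m len in \<open>auto simp: ds_def\<close>)
  then have "(ac_move G)\<^sup>*\<^sup>* vs ds"
    using R_ng[OF vs(1)] by (intro ac_mod_trivial) (simp_all add: normally_generating_def)
  then have "(ac_move G)\<^sup>*\<^sup>* us ds" using vs(1) by (auto simp: R_def)
  moreover have "clean (Suc m) k ds"
    unfolding clean_def
  proof (intro allI impI)
    fix i j assume i: "i < k" and j: "j < Suc m"
    have "e j (ds ! i) = (if i = m then e j (vs ! m) else - e m (vs ! i) * e j (vs ! m) + e j (vs ! i))"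
      using i cc[OF i] cc[OF m] by (simp add: ds_def add e)
    then show "e j (ds ! i) = (if i = j then 1 else 0)"
      using R_cl[OF vs(1) m, of j] R_cl[OF vs(1) i, of j] vs(2) j by (cases "j = m") auto
  qed
  ultimately show ?thesis by blast
qed

lemma ac_moves_dual_basis:
  fixes e :: "nat \<Rightarrow> 'a \<Rightarrow> int"
  assumes add: "\<And>j x y. x \<in> carrier G \<Longrightarrow> y \<in> carrier G \<Longrightarrow> e j (x \<otimes> y) = e j x + e j y"
    and dual: "\<And>m. m < k \<Longrightarrow> \<exists>x\<in>carrier G. \<forall>j<k. e j x = (if j = m then 1 else 0)"
    and us: "us \<in> normally_generating k G"
  obtains vs where "(ac_move G)\<^sup>*\<^sup>* us vs"
    "\<And>i j. i < k \<Longrightarrow> j < k \<Longrightarrow> e j (vs ! i) = (if i = j then 1 else 0)"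
proof -
  have "m \<le> k \<Longrightarrow> \<exists>vs. (ac_move G)\<^sup>*\<^sup>* us vs \<and> (\<forall>i<k. \<forall>j<m. e j (vs ! i) = (if i = j then 1 else 0))" for m
  proof (induction m)
    case (Suc m)
    then obtain vs where vs: "(ac_move G)\<^sup>*\<^sup>* us vs" "\<forall>i<k. \<forall>j<m. e j (vs ! i) = (if i = j then 1 else 0)"
      by auto
    obtain x where x: "x \<in> carrier G" "\<And>j. j < k \<Longrightarrow> e j x = (if j = m then 1 else 0)"
      using dual[of m] Suc.prems by auto
    have "m < k" using Suc.prems by simp
    then show ?case
      using ac_moves_clear_column[OF add x ac_moves_normally_generating[OF vs(1) us] _ vs(2)] vs(1)
      by (meson rtranclp_trans)
  qed auto
  then show ?thesis using that by blast
qed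

end

section \<open>Exponent sums in the free group\<close>

definition exponent_sum :: "'s \<Rightarrow> 's letter list \<Rightarrow> int" where
  "exponent_sum s w = (\<Sum>x\<leftarrow>w. if fst x = s then if snd x then 1 else - 1 else 0)"

lemma exponent_sum_simps [simp]:
  "exponent_sum s [] = 0"
  "exponent_sum s (x # w) = (if fst x = s then if snd x then 1 else - 1 else 0) + exponent_sum s w"
  "exponent_sum s (u @ v) = exponent_sum s u + exponent_sum s v"
  by (simp_all add: exponent_sum_def)

lemma exponent_sum_lcons: "exponent_sum s (lcons x w) = exponent_sum s (x # w)"
  by (cases w) (auto simp: inv_letter_def)

lemma exponent_sum_mult:
  "exponent_sum s (u \<otimes>\<^bsub>free_group S\<^esub> v) = exponent_sum s u + exponent_sum s v"
proof -
  have "exponent_sum s (foldr lcons u v) = exponent_sum s u + exponent_sum s v"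
    by (induction u) (simp_all add: exponent_sum_lcons)
  then show ?thesis by (simp add: free_group_def)
qed

lemma inv_letter_mem_of_exponent_sum:
  assumes "exponent_sum (fst x) (x # w) = 0"
  shows "inv_letter x \<in> set w"
proof (rule ccontr)
  assume "inv_letter x \<notin> set w"
  then have "if snd x then exponent_sum (fst x) w \<ge> 0 else exponent_sum (fst x) w \<le> 0"
  proof (induction w)
    case (Cons y w)
    then show ?case by (cases x; cases y) (auto simp: inv_letter_def split: if_splits)
  qed simp
  then show False using assms by (auto split: if_splits)
qed

text \<open>
  If the word \<open>x # u\<close> has zero exponent sums, then \<open>u = a @ x\<^sup>-\<^sup>1 # b\<close>, and \<open>x a x\<^sup>-\<^sup>1 b = [x, a] a b\<close> reduces the claim to
  the shorter word \<open>a @ b\<close>.  The shorter word need not be reduced, so the induction runs over all words.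
\<close>

lemma (in group) eval_word_in_derived:
  assumes h: "h \<in> S \<rightarrow> carrier G" and "fst ` set w \<subseteq> S" and "\<And>s. exponent_sum s w = 0"
  shows "eval_word h w \<in> derived G (carrier G)"
  using assms(2,3)
proof (induction w rule: length_induct)
  case (1 w)
  interpret D: normal "derived G (carrier G)" G
    by (rule derived_self_is_normal)
  show ?case
  proof (cases w)
    case Nil
    then show ?thesis by (simp add: eval_word_def)
  next
    case (Cons x u)
    have "inv_letter x \<in> set u"
      using 1(3)[of "fst x"] Cons by (intro inv_letter_mem_of_exponent_sum) simp
    then obtain a b where u: "u = a @ inv_letter x # b" by (auto dest: split_list)
    have app: "eval_word h (p @ q) = eval_word h p \<otimes> eval_word h q"
      if "fst ` set p \<subseteq> S" "fst ` set q \<subseteq> S" for p q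
      using that
      by (induction p) (auto simp: eval_word_def m_assoc eval_letter_closed[OF h]
          eval_word_closed[OF h, unfolded eval_word_def])
    have S: "fst x \<in> S" "fst ` set a \<subseteq> S" "fst ` set b \<subseteq> S" using 1(2) Cons u by auto
    have c: "eval_letter h x \<in> carrier G" "eval_word h a \<in> carrier G" "eval_word h b \<in> carrier G"
      using S eval_letter_closed[OF h] eval_word_closed[OF h] by auto
    have "h (fst x) \<in> carrier G" using h S by blast
    then have inv: "eval_letter h (inv_letter x) = inv (eval_letter h x)"
      by (auto simp: eval_letter_def inv_letter_def)
    have "eval_word h w = eval_letter h x \<otimes> (eval_word h a \<otimes> (inv (eval_letter h x) \<otimes> eval_word h b))"
      using S by (simp add: Cons u eval_word_Cons app inv)
    also have "\<dots> = commutator (eval_letter h x) (eval_word h a) \<otimes> (eval_word h a \<otimes> eval_word h b)"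
    proof -
      have "inv (eval_word h a) \<otimes> (eval_word h a \<otimes> eval_word h b) = eval_word h b"
        using c by (simp add: m_assoc[symmetric])
      then show ?thesis using c by (simp add: commutator_def m_assoc)
    qed
    also have "eval_word h a \<otimes> eval_word h b = eval_word h (a @ b)" using S by (simp add: app)
    finally have w: "eval_word h w = commutator (eval_letter h x) (eval_word h a) \<otimes> eval_word h (a @ b)" .
    have "exponent_sum s (a @ b) = 0" for s
      using 1(3)[of s] by (auto simp: Cons u inv_letter_def split: if_splits)
    moreover have "length (a @ b) < length w" "fst ` set (a @ b) \<subseteq> S"
      using S by (auto simp: Cons u)
    ultimately have "eval_word h (a @ b) \<in> derived G (carrier G)"
      using 1(1) by blast
    then show ?thesis using w c commutator_in_derived by simp
  qed
qed

lemma exponent_sum_eq_0: "s \<notin> fst ` set w \<Longrightarrow> exponent_sum s w = 0"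
  by (induction w) auto

lemma (in group) hom_in_derived:
  assumes f: "f \<in> hom (free_group S) G" and w: "w \<in> carrier (free_group S)"
    and 0: "\<And>s. s \<in> S \<Longrightarrow> exponent_sum s w = 0"
  shows "f w \<in> derived G (carrier G)"
proof -
  define h where "h s = f [(s, True)]" for s
  have h: "h \<in> S \<rightarrow> carrier G"
    using hom_in_carrier[OF f] by (auto simp: h_def free_group_def reduced_Cons)
  have "f w = eval_word h w"
    using free_group_universal(2)[OF h f eval_word_hom[OF h] _ _ w] h
    by (auto simp: h_def eval_word_def eval_letter_def Pi_iff)
  moreover have "fst ` set w \<subseteq> S" using w by (simp add: free_group_def)
  moreover have "exponent_sum s w = 0" for s
    using 0[of s] exponent_sum_eq_0[of s w] \<open>fst ` set w \<subseteq> S\<close> by blast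
  ultimately show ?thesis using eval_word_in_derived[OF h] by simp
qed

section \<open>Connectedness of the image\<close>

lemma ac_moves_lift:
  assumes "group_hom F G \<phi>" and surj: "\<phi> ` carrier F = carrier G"
    and xs: "set xs \<subseteq> carrier F" and "(ac_move G)\<^sup>*\<^sup>* (map \<phi> xs) cs"
  obtains ys where "(ac_move F)\<^sup>*\<^sup>* xs ys" "map \<phi> ys = cs"
proof -
  interpret group_hom F G \<phi> by fact
  have "\<exists>ys. (ac_move F)\<^sup>*\<^sup>* xs ys \<and> set ys \<subseteq> carrier F \<and> map \<phi> ys = cs"
    using assms(4)
  proof induction
    case base
    then show ?case using xs by blast
  next
    case (step cs ds)
    then obtain ys where ys: "(ac_move F)\<^sup>*\<^sup>* xs ys" "set ys \<subseteq> carrier F" "map \<phi> ys = cs" by blast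
    obtain zs where zs: "ac_move F ys zs" "map \<phi> zs = ds"
      using ac_move_lift[OF assms(1) surj ys(2)] step(2) ys(3) by blast
    moreover have "set zs \<subseteq> carrier F"
      using G.ac_move_in_normal[OF zs(1) G.normal_self ys(2)] .
    ultimately show ?case
      using rtranclp.rtrancl_into_rtrancl[OF ys(1)] by blast
  qed
  then show ?thesis using that by blast
qed

text \<open>
  Both tuples are moved to tuples with standard exponent vectors; the images of these are congruent
  modulo the derived subgroup and hence connected in \<open>G\<close>.  The resulting path from the image of \<open>us\<close> to
  the image of \<open>vs\<close> lifts to a path from \<open>us\<close>, which need not end in \<open>vs\<close> but only in its fibre.
\<close>

lemma ac_moves_to_fibre:
  fixes G :: "('a, 'b) monoid_scheme" and \<phi> :: "nat letter list \<Rightarrow> 'a"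
  assumes k: "2 \<le> k" and G: "group G" "finite (carrier G)" and \<phi>: "\<phi> \<in> epi (free_group_rank k) G"
    and us: "us \<in> normally_generating k (free_group_rank k)"
    and vs: "vs \<in> normally_generating k (free_group_rank k)"
  obtains ws where "(ac_move (free_group_rank k))\<^sup>*\<^sup>* us ws" "map \<phi> ws = map \<phi> vs"
proof -
  let ?F = "free_group_rank k"
  interpret F: group ?F by (rule group_free_group)
  interpret G: group G by (rule G)
  have hom: "\<phi> \<in> hom ?F G" and surj: "\<phi> ` carrier ?F = carrier G" using \<phi> by (auto simp: epi_def)
  interpret \<phi>: group_hom ?F G \<phi>
    using hom by (simp add: group_hom_def group_hom_axioms_def F.is_group G)
  have dual: "\<exists>x\<in>carrier ?F. \<forall>j<k. exponent_sum j x = (if j = m then 1 else 0)" if "m < k" for m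
    using that by (intro bexI[of _ "[(m, True)]"]) (auto simp: free_group_def reduced_Cons)
  have nf: "\<exists>xs'. (ac_move ?F)\<^sup>*\<^sup>* xs xs' \<and> xs' \<in> normally_generating k ?F \<and>
      (\<forall>i<k. \<forall>j<k. exponent_sum j (xs' ! i) = (if i = j then 1 else 0))"
    if "xs \<in> normally_generating k ?F" for xs
    using F.ac_moves_dual_basis[OF exponent_sum_mult dual that] F.ac_moves_normally_generating[OF _ that] by metis
  obtain us' where us': "(ac_move ?F)\<^sup>*\<^sup>* us us'" "us' \<in> normally_generating k ?F"
    "\<And>i j. i < k \<Longrightarrow> j < k \<Longrightarrow> exponent_sum j (us' ! i) = (if i = j then 1 else 0)"
    using nf[OF us] by blast
  obtain vs' where vs': "(ac_move ?F)\<^sup>*\<^sup>* vs vs'" "vs' \<in> normally_generating k ?F"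
    "\<And>i j. i < k \<Longrightarrow> j < k \<Longrightarrow> exponent_sum j (vs' ! i) = (if i = j then 1 else 0)"
    using nf[OF vs] by blast
  have c: "length xs = k" "set xs \<subseteq> carrier ?F" if "xs \<in> normally_generating k ?F" for xs
    using that by (auto simp: normally_generating_def)
  let ?D = "derived G (carrier G)"
  have D: "subgroup ?D G" by (simp add: G.derived_is_subgroup)
  have "map ((#>\<^bsub>G\<^esub>) ?D) (map \<phi> us') = map ((#>\<^bsub>G\<^esub>) ?D) (map \<phi> vs')"
  proof (rule nth_equalityI)
    fix i assume "i < length (map ((#>\<^bsub>G\<^esub>) ?D) (map \<phi> us'))"
    then have i: "i < k" using c(1)[OF us'(2)] by simp
    have ci: "us' ! i \<in> carrier ?F" "vs' ! i \<in> carrier ?F"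
      using i c[OF us'(2)] c[OF vs'(2)] by auto
    have "\<phi> (us' ! i \<otimes>\<^bsub>?F\<^esub> inv\<^bsub>?F\<^esub> (vs' ! i)) \<in> ?D"
    proof (rule G.hom_in_derived[OF hom])
      fix s :: nat assume "s \<in> {..<k}"
      then show "exponent_sum s (us' ! i \<otimes>\<^bsub>?F\<^esub> inv\<^bsub>?F\<^esub> (vs' ! i)) = 0"
        using us'(3) vs'(3) i ci F.additive_int_simps(2)[of "exponent_sum s" "vs' ! i", OF exponent_sum_mult]
        by (simp add: exponent_sum_mult)
    qed (use ci in simp)
    then have "\<phi> (us' ! i) \<otimes>\<^bsub>G\<^esub> inv\<^bsub>G\<^esub> \<phi> (vs' ! i) \<in> ?D" using ci by simp
    then show "map ((#>\<^bsub>G\<^esub>) ?D) (map \<phi> us') ! i = map ((#>\<^bsub>G\<^esub>) ?D) (map \<phi> vs') ! i"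
      using G.rcos_eq_iff[OF D, of "\<phi> (us' ! i)" "\<phi> (vs' ! i)"] ci i c(1)[OF us'(2)] c(1)[OF vs'(2)] by simp
  qed (simp add: c(1)[OF us'(2)] c(1)[OF vs'(2)])
  then have "(ac_move G)\<^sup>*\<^sup>* (map \<phi> us') (map \<phi> vs')"
    using G.ac_moves_of_derived_eq[OF G(2) k] map_normally_generating[OF F.is_group G(1) \<phi>] us'(2) vs'(2)
    by blast
  then obtain zs where zs: "(ac_move ?F)\<^sup>*\<^sup>* us' zs" "map \<phi> zs = map \<phi> vs'"
    using ac_moves_lift[OF \<phi>.group_hom_axioms surj c(2)[OF us'(2)]] by blast
  have zg: "zs \<in> normally_generating k ?F" using F.ac_moves_normally_generating[OF zs(1) us'(2)] .
  have vs_back: "(ac_move ?F)\<^sup>*\<^sup>* vs' vs"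
    using F.ac_mod_trivial[OF F.ac_mod_sym[OF F.ac_moves_imp_ac_mod[OF vs'(1)] F.one_is_normal c(2)[OF vs]] c(2)[OF vs'(2)]] .
  have "(ac_move G)\<^sup>*\<^sup>* (map \<phi> zs) (map \<phi> vs)"
  proof -
    have "set xs \<subseteq> carrier ?F \<Longrightarrow> (ac_move G)\<^sup>*\<^sup>* (map \<phi> xs) (map \<phi> ys)" if "(ac_move ?F)\<^sup>*\<^sup>* xs ys" for xs ys
      using that
    proof (induction rule: converse_rtranclp_induct)
      case (step xs ys)
      then show ?case
        using map_ac_move[OF \<phi>.group_hom_axioms] F.ac_move_in_normal[OF _ F.normal_self]
        by (meson converse_rtranclp_into_rtranclp)
    qed simp
    then show ?thesis using vs_back c(2)[OF vs'(2)] zs(2) by simp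
  qed
  then obtain ws where ws: "(ac_move ?F)\<^sup>*\<^sup>* zs ws" "map \<phi> ws = map \<phi> vs"
    using ac_moves_lift[OF \<phi>.group_hom_axioms surj c(2)[OF zg]] by blast
  then show ?thesis using that us'(1) zs(1) by (meson rtranclp_trans)
qed

lemma generators_normally_generating:
  "map (\<lambda>s. [(s, True)]) [0..<k] \<in> normally_generating k (free_group_rank k)"
proof -
  let ?F = "free_group_rank k" and ?xs = "map (\<lambda>s. [(s, True)]) [0..<k] :: nat letter list list"
  interpret F: group ?F by (rule group_free_group)
  have c: "set ?xs \<subseteq> carrier ?F" by (auto simp: free_group_def reduced_Cons)
  have "w \<in> N" if N: "N \<lhd> ?F" "set ?xs \<subseteq> N" and "w \<in> carrier ?F" for N w
    using that(3)
  proof (induction w)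
    interpret N: normal N ?F by (rule N(1))
    {
      case Nil
      show ?case using N.one_closed by (simp add: free_group_def)
    next
      case (Cons x w)
      have w: "w \<in> carrier ?F" and x: "[x] \<in> carrier ?F" "fst x < k"
        "[inv_letter x] \<in> carrier ?F"
        using Cons.prems by (auto simp: free_group_def reduced_Cons)
      have "[x] \<in> N"
      proof (cases "snd x")
        case True
        then show ?thesis using N(2) x by (cases x) auto
      next
        case False
        then have "[inv_letter x] \<in> N" using N(2) x by (cases x) (auto simp: inv_letter_def)
        moreover have "[x] \<otimes>\<^bsub>?F\<^esub> [inv_letter x] = \<one>\<^bsub>?F\<^esub>"
          by (simp add: free_group_def)
        then have "[x] = inv\<^bsub>?F\<^esub> [inv_letter x]" using x F.inv_equality by metis
        ultimately show ?thesis using N.m_inv_closed by metis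
      qed
      then have "[x] \<otimes>\<^bsub>?F\<^esub> w \<in> N" using Cons.IH[OF w] by simp
      moreover have "[x] \<otimes>\<^bsub>?F\<^esub> w = x # w"
        using Cons.prems by (simp add: free_group_def lcons_reduced)
      ultimately show ?case by simp
    }
  qed
  then have "carrier ?F \<subseteq> normal_closure ?F (set ?xs)"
    unfolding normal_closure_def by blast
  moreover have "normal_closure ?F (set ?xs) \<subseteq> carrier ?F"
    using c by (intro F.normal_closure_least[OF F.normal_self])
  ultimately show ?thesis using c by (simp add: normally_generating_def)
qed

theorem corollary1p3:
  fixes k :: nat and G :: "('a, 'b) monoid_scheme" and \<phi> :: "nat letter list \<Rightarrow> 'a"
  assumes "k \<ge> 2"
    and "group G" and "finite (carrier G)"
    and "\<phi> \<in> epi (free_group_rank k) G"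
  shows "let I = graph_image (map \<phi>) (ac_graph k (free_group_rank k))
         in subgraph I (ac_graph k G) \<and> connected I"
proof -
  let ?F = "free_group_rank k"
  interpret F: group ?F by (rule group_free_group)
  define I where "I = graph_image (map \<phi>) (ac_graph k ?F)"
  let ?S = "mk_symmetric (with_proj I)"
  have path: "map \<phi> us \<rightarrow>\<^sup>*\<^bsub>?S\<^esub> map \<phi> ws"
    if "(ac_move ?F)\<^sup>*\<^sup>* us ws" and us: "us \<in> normally_generating k ?F" for us ws
    using that(1)
  proof induction
    case base
    then show ?case using us
      by (auto simp: reachable_def I_def graph_image_def ac_graph_def intro!: rtrancl_on_refl)
  next
    case (step ws xs)
    have "ws \<in> normally_generating k ?F" "xs \<in> normally_generating k ?F"
      using step(1,2) us F.ac_moves_normally_generating by (meson rtranclp.rtrancl_into_rtrancl)+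
    then have "(map \<phi> ws, map \<phi> xs) \<in> parcs I" "map \<phi> xs \<in> pverts I"
      using step(2) by (force simp: I_def graph_image_def ac_graph_def)+
    then have "(map \<phi> ws, map \<phi> xs) \<in> arcs_ends ?S" "map \<phi> xs \<in> verts ?S"
      by (auto simp: mk_symmetric_def arcs_ends_def arc_to_ends_def)
    then show ?case using step(3) unfolding reachable_def by (meson rtrancl_on_into_rtrancl_on)
  qed
  have "map \<phi> us \<rightarrow>\<^sup>*\<^bsub>?S\<^esub> map \<phi> vs"
    if us: "us \<in> normally_generating k ?F" and vs: "vs \<in> normally_generating k ?F" for us vs
  proof -
    obtain ws where "(ac_move ?F)\<^sup>*\<^sup>* us ws" "map \<phi> ws = map \<phi> vs"
      using ac_moves_to_fibre[OF assms us vs] .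
    then show ?thesis using path[OF _ us, of ws] by simp
  qed
  moreover have "normally_generating k ?F \<noteq> {}"
    using generators_normally_generating[of k] by blast
  ultimately have "connected I"
    unfolding connected_def strongly_connected_def
    by (auto simp: I_def graph_image_def ac_graph_def)
  moreover have "subgraph I (ac_graph k G)"
    unfolding I_def by (rule graph_image_subgraph[OF F.is_group assms(2,4)])
  ultimately show ?thesis by (simp add: I_def Let_def)
qed

end
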